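(* Let $R$ be a Gorenstein local ring with maximal ideal $\mathfrak m$, infinite residue field, and $2,3\notin\mathfrak m$. Let $I\subset R$ be a perfect ideal of height $3$ such that the minimal free resolution $\mathbb{A}:0\to A_3\xrightarrow{a_3}A_2\xrightarrow{a_2}A_1\xrightarrow{a_1}R$ of $R/I$ has format $(1,5,6,2)$ (so $r_1=\operatorname{rank}A_1=5$, $r_2=\operatorname{rank}A_2=6$, $\operatorname{rank}A_3=2$). Let $\mathfrak a\subset I$ be a regular sequence of length $3$, $J=(\mathfrak a):I$, and let $\mathbb{D}:0\to D_3=A_1^*\to D_2=A_2^*\oplus B_2\to D_1=A_3^*\oplus B_1\to R$ be the mapping-cone resolution of $R/J$ described in the context, with $D_1$ having basis $\gamma_1,\gamma_2,s_1,s_2,s_3$ and with the structure maps $w^{(3)}_1,w^{(3)}_2$ on $\mathbb{D}$ given there. Put $\varepsilon=\gamma_1\wedge\gamma_2\wedge s_1\wedge s_2\wedge s_3$ and $\varepsilon_{i,k,s_1,s_2,s_3}=e_i\wedge e_k\wedge\alpha_1(s_1)\wedge\alpha_1(s_2)\wedge\alpha_1(s_3)$. Then the structure map $w^{(3)}_3:\bigwedge^5D_1\otimes D_1\to\bigwedge^2D_3\otimes D_2$ of $\mathbb{D}$ is computed by (that is, the following formulas define a valid lift) $$w^{(3)}_3(\varepsilon\otimes s_j)=\sum_{1\le i<k\le r_1}\ \sum_{h=1}^{r_2}\langle w^{(2)}_2(e_i\wedge e_k\wedge\alpha_1(s_j)\otimes f_h),\gamma_1\wedge\gamma_2\rangle\,(\epsilon_i\wedge\epsilon_k\otimes\phi_h),\quad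 j=1,2,3,$$ $$w^{(3)}_3(\varepsilon\otimes\gamma_u)=\sum_{1\le i<k\le r_1}\ \sum_{h=1}^{r_2}\langle w^{(2)}_3(\varepsilon_{i,k,s_1,s_2,s_3}\otimes f_h),\gamma_1\wedge\gamma_2\otimes\gamma_u\rangle\,(\epsilon_i\wedge\epsilon_k\otimes\phi_h),\quad u=1,2,$$ where $w^{(2)}_2$ and $w^{(2)}_3$ on the right are structure maps of $\mathbb{A}$.
   Context: Bases: $\{e_i\}$, $\{f_h\}$, $\{g_u\}$ of $A_1,A_2,A_3$; dual bases $\{\epsilon_i\},\{\phi_h\},\{\gamma_u\}$. $\langle\cdot,\cdot\rangle$ is evaluation; exterior powers are paired by determinants. Structure maps for an acyclic complex $0\to F_3\xrightarrow{d_3}F_2\xrightarrow{d_2}F_1\xrightarrow{d_1}R$ of free modules, chosen successively as $R$-linear lifts: - $w^{(3)}_1:\bigwedge^2F_1\to F_2$, $e\cdot e'$, with $d_2(e\cdot e')=d_1(e)e'-d_1(e')e$. - $w^{(2)}_1:F_1\otimes F_2\to F_3$, $e\cdot f$, with $d_3(e\cdot f)=d_1(e)f-e\cdot d_2(f)$. - $w^{(1)}_1:\bigwedge^3F_1\to F_3$, $e\cdot e'\cdot e''$, with $d_3(e\cdot e'\cdot e'')=d_1(e)\,e'\cdot e''-d_1(e')\,e\cdot e''+d_1(e'')\,e\cdot e'$. - $w^{(3)}_2:\bigwedge^4F_1\to F_3\otimes F_2$: a lift, along $F_3\otimes F_2\to S_2F_2$, $g\otimes f\mapsto d_3(g)f$,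 of $e_i\wedge e_j\wedge e_k\wedge e_l\mapsto(e_i\cdot e_j)(e_k\cdot e_l)-(e_i\cdot e_k)(e_j\cdot e_l)+(e_i\cdot e_l)(e_j\cdot e_k)$. - $w^{(2)}_2:\bigwedge^3F_1\otimes F_2\to\bigwedge^2F_3$: the lift, along $\bigwedge^2F_3\to F_2\otimes F_3\,(\cong F_3\otimes F_2)$, $g\wedge g'\mapsto d_3(g)\otimes g'-d_3(g')\otimes g$, of $e_i\wedge e_j\wedge e_k\otimes f\mapsto e_i\cdot e_j\otimes e_k\cdot f-e_i\cdot e_k\otimes e_j\cdot f+e_j\cdot e_k\otimes e_i\cdot f+w^{(3)}_2(e_i\wedge e_j\wedge e_k\wedge d_2(f))-f\otimes e_i\cdot e_j\cdot e_k$. Now suppose $F_1$ has rank 5 with ordered basis $y_1,\dots,y_5$ and write $w^{(3)}_2(\hat y_i)$ for $w^{(3)}_2$ of the wedge, in increasing order, of the $y_j$ with $j\ne i$. - $w^{(3)}_3(y_1\wedge\dots\wedge y_5\otimes y_k)$ is a lift, along $\bigwedge^2F_3\otimes F_2\to F_3\otimes S_2F_2$, $(g\wedge g')\otimes f\mapsto g\otimes d_3(g')f-g'\otimes d_3(g)f$, of the image in $F_3\otimes S_2F_2$ of $\sum_{i\ne k}(-1)^{i+1}w^{(3)}_2(\hat y_i)\otimes(y_k\cdot y_i)$. - If moreover $F_3$ has rank 2: $w^{(1)}_{2,2}(y_1\wedge\dots\wedge y_5)\in S_2F_3$ is the lift of $\sum_{i<j}(-1)^{i+j+1}y_i\cdot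 y_j\otimes y_k\cdot y_l\cdot y_m\in F_2\otimes F_3$ ($k<l<m$ the remaining indices) along $S_2F_3\to F_2\otimes F_3$, $gg'\mapsto\frac12(d_3(g)\otimes g'+d_3(g')\otimes g)$; and $w^{(2)}_3(y_1\wedge\dots\wedge y_5\otimes f)\in\bigwedge^2F_3\otimes F_3$ is the lift, along $\bigwedge^2F_3\otimes F_3\to S_2F_3\otimes F_2$, $(a\wedge b)\otimes c\mapsto cb\otimes d_3(a)-ca\otimes d_3(b)$, of $\sum_{i=1}^5(-1)^{i+1}(y_i\cdot f)\,w^{(3)}_2(\hat y_i)-\frac12w^{(1)}_{2,2}(y_1\wedge\dots\wedge y_5)\otimes f$, where $g\,(g'\otimes f')=gg'\otimes f'$. The complex $\mathbb{D}$. $\mathbb{B}$ is the Koszul complex on $\mathfrak a$, with differentials $b_i$, bases $\{s_1,s_2,s_3\}$ of $B_1$, $\{t_1,t_2,t_3\}$ of $B_2$, and Koszul products $s_is_j=(-1)^{i+j+1}t_k$ for $i<j$, $\{i,j,k\}=\{1,2,3\}$ (so $b_2(s_is_j)=b_1(s_i)s_j-b_1(s_j)s_i$). $\alpha_1:B_1\to A_1$, $\alpha_1(s_j)=\sum_iu_{ij}e_i$, satisfies $a_1\alpha_1=b_1$. Put $\beta_1(\epsilon_k)=\sum_ju_{kj}t_j$, $\beta_2(\phi_h)=\sum_{j=1}^3(-1)^{j+1}\langle\alpha_1(s_{k_1})\cdot\alpha_1(s_{k_2}),\phi_h\rangle s_j$ with $k_1<k_2$ the indices in $\{1,2,3\}\setminus\{j\}$,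 and $\beta_3(\gamma_u)=\langle\alpha_1(s_1)\cdot\alpha_1(s_2)\cdot\alpha_1(s_3),\gamma_u\rangle$. The differentials of $\mathbb{D}$ are $d_1=\begin{bmatrix}\beta_3&b_1\end{bmatrix}$, $d_2=\begin{bmatrix}a_3^*&0\\-\beta_2&-b_2\end{bmatrix}$, $d_3=\begin{bmatrix}a_2^*\\\beta_1\end{bmatrix}$. Chosen structure maps on $\mathbb{D}$: $w^{(3)}_1$ is the alternating product with $s_i\cdot s_j=(-1)^{i+j}t_k$ ($i<j$, $k$ the third index), $s_i\cdot\gamma_t=\sum_h\langle\alpha_1(s_i)\cdot f_h,\gamma_t\rangle\phi_h$, $\gamma_1\cdot\gamma_2=\sum_h\langle w^{(2)}_2(\alpha_1(s_1)\wedge\alpha_1(s_2)\wedge\alpha_1(s_3)\otimes f_h),\gamma_1\wedge\gamma_2\rangle\phi_h$; and $w^{(3)}_2$ is given by $w^{(3)}_2(\gamma_u\wedge s_1\wedge s_2\wedge s_3)=\sum_{i,h}\langle e_i\cdot f_h,\gamma_u\rangle\,\epsilon_i\otimes\phi_h$ and, for $p<q$, $w^{(3)}_2(\gamma_1\wedge\gamma_2\wedge s_p\wedge s_q)=-\sum_{i,h}\langle w^{(2)}_2(e_i\wedge\alpha_1(s_p)\wedge\alpha_1(s_q)\otimes f_h),\gamma_1\wedge\gamma_2\rangle\,\epsilon_i\otimes\phi_h$. *)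

theory Defs
  imports
    "HOL-Analysis.Analysis"
    "HOL-Algebra.Ring_Divisibility"
    "HOL-Algebra.QuotRing"
    "HOL-Algebra.Module"
    "HOL-Library.Uprod"
    "HOL-Library.Extended_Nat"
begin

section \<open>Commutative algebra\<close>

text \<open>The base ring is a type \<open>'a :: comm_ring_1\<close>.  Ideals, Noetherianity and residue rings are
  those of \<open>HOL-Algebra\<close>, applied to this type viewed as a ring record.\<close>

definition RR :: "'a::comm_ring_1 ring" where
  "RR = \<lparr>carrier = UNIV, mult = (*), one = 1, zero = 0, add = (+)\<rparr>"

definition self_module :: "('a::comm_ring_1, 'a) module" where
  "self_module = \<lparr>carrier = UNIV, mult = (*), one = 1, zero = 0, add = (+), smult = (*)\<rparr>"

definition mod_hom :: "'a ring \<Rightarrow> ('a, 'b) module \<Rightarrow> ('a, 'c) module \<Rightarrow> ('b \<Rightarrow> 'c) set" where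
  "mod_hom R M N = {f \<in> carrier M \<rightarrow> carrier N.
     (\<forall>x\<in>carrier M. \<forall>y\<in>carrier M. f (x \<oplus>\<^bsub>M\<^esub> y) = f x \<oplus>\<^bsub>N\<^esub> f y) \<and>
     (\<forall>r\<in>carrier R. \<forall>x\<in>carrier M. f (r \<odot>\<^bsub>M\<^esub> x) = r \<odot>\<^bsub>N\<^esub> f x)}"

text \<open>The test modules \<open>M\<close>, \<open>N\<close> have their elements in the same type as \<open>E\<close>.  By Baer's criterion
  this is injectivity in the category of all modules as soon as that type is at least as large
  as the ring.\<close>

definition injective_module :: "'a ring \<Rightarrow> ('a, 'b) module \<Rightarrow> bool" where
  "injective_module R E \<longleftrightarrow> Module.module R E \<and>
     (\<forall>(M :: ('a, 'b) module) (N :: ('a, 'b) module) \<iota> f.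
        Module.module R M \<and> Module.module R N \<and>
        \<iota> \<in> mod_hom R M N \<and> inj_on \<iota> (carrier M) \<and> f \<in> mod_hom R M E \<longrightarrow>
        (\<exists>g \<in> mod_hom R N E. \<forall>x\<in>carrier M. g (\<iota> x) = f x))"

text \<open>Finite injective dimension of the ring over itself: a bounded injective resolution
  \<open>0 \<rightarrow> R \<rightarrow> E\<^sub>0 \<rightarrow> E\<^sub>1 \<rightarrow> \<dots>\<close>.  The modules \<open>E\<^sub>i\<close> have elements of type \<open>'a set\<close>; for a Noetherian
  ring the terms of the minimal injective resolution are small enough to be realized there
  (for infinite \<open>R\<close> they have at most \<open>|R|\<^sup>\<omega>\<close> elements).\<close>

definition finite_self_injective_dimension :: "'a::comm_ring_1 itself \<Rightarrow> bool" where
  "finite_self_injective_dimension _ \<longleftrightarrow>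
     (\<exists>(n :: nat) (E :: nat \<Rightarrow> ('a, 'a set) module) \<eta> \<delta>.
        (\<forall>i. injective_module RR (E i)) \<and>
        (\<forall>i>n. carrier (E i) = {\<zero>\<^bsub>E i\<^esub>}) \<and>
        \<eta> \<in> mod_hom RR self_module (E 0) \<and> inj \<eta> \<and>
        (\<forall>i. \<delta> i \<in> mod_hom RR (E i) (E (Suc i))) \<and>
        range \<eta> = {y \<in> carrier (E 0). \<delta> 0 y = \<zero>\<^bsub>E 1\<^esub>} \<and>
        (\<forall>i. \<delta> i ` carrier (E i) =
              {y \<in> carrier (E (Suc i)). \<delta> (Suc i) y = \<zero>\<^bsub>E (Suc (Suc i))\<^esub>}))"

definition noetherian_local_ring :: "'a::comm_ring_1 set \<Rightarrow> bool" where
  "noetherian_local_ring m \<longleftrightarrow> noetherian_ring (RR :: 'a ring) \<and> maximalideal m RR \<and>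
     (\<forall>M. maximalideal M RR \<longrightarrow> M = m)"

definition gorenstein_local_ring :: "'a::comm_ring_1 set \<Rightarrow> bool" where
  "gorenstein_local_ring m \<longleftrightarrow>
     noetherian_local_ring m \<and> finite_self_injective_dimension TYPE('a)"

definition prime_height :: "'a::comm_ring_1 set \<Rightarrow> enat" where
  "prime_height P = (SUP n \<in> {n. \<exists>C :: nat \<Rightarrow> 'a set.
      (\<forall>i\<le>n. primeideal (C i) RR) \<and> (\<forall>i<n. C i \<subset> C (Suc i)) \<and> C n = P}. enat n)"

definition ideal_height :: "'a::comm_ring_1 set \<Rightarrow> enat" where
  "ideal_height I = (INF P \<in> {P. primeideal P RR \<and> I \<subseteq> P}. prime_height P)"

definition regular_sequence :: "'a::comm_ring_1 list \<Rightarrow> bool" where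
  "regular_sequence xs \<longleftrightarrow> genideal RR (set xs) \<noteq> UNIV \<and>
     (\<forall>i<length xs. \<forall>r. xs ! i * r \<in> genideal RR (set (take i xs)) \<longrightarrow>
        r \<in> genideal RR (set (take i xs)))"

definition grade :: "'a::comm_ring_1 set \<Rightarrow> enat" where
  "grade I = (SUP xs \<in> {xs. regular_sequence xs \<and> set xs \<subseteq> I}. enat (length xs))"

definition free_mod :: "nat \<Rightarrow> (nat \<Rightarrow> 'a::comm_ring_1) set" where
  "free_mod n = {v. \<forall>i\<ge>n. v i = 0}"

definition mat_map ::
  "nat \<Rightarrow> nat \<Rightarrow> (nat \<Rightarrow> nat \<Rightarrow> 'a::comm_ring_1) \<Rightarrow> (nat \<Rightarrow> 'a) \<Rightarrow> nat \<Rightarrow> 'a" where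
  "mat_map p q M v = (\<lambda>i. if i < p then \<Sum>j<q. M i j * v j else 0)"

text \<open>A resolution \<open>0 \<rightarrow> F\<^sub>n \<rightarrow> \<dots> \<rightarrow> F\<^sub>1 \<rightarrow> F\<^sub>0 = R\<close> of \<open>R/I\<close> by free modules of finite ranks
  \<open>r k\<close>, the map \<open>F\<^bsub>k+1\<^esub> \<rightarrow> F\<^sub>k\<close> being given by the matrix \<open>M k\<close>.\<close>

definition finite_free_resolution ::
  "'a::comm_ring_1 set \<Rightarrow> nat \<Rightarrow> (nat \<Rightarrow> nat) \<Rightarrow> (nat \<Rightarrow> nat \<Rightarrow> nat \<Rightarrow> 'a) \<Rightarrow> bool" where
  "finite_free_resolution I n r M \<longleftrightarrow> r 0 = 1 \<and> (\<forall>k>n. r k = 0) \<and>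
     (\<lambda>v. mat_map (r 0) (r 1) (M 0) v 0) ` free_mod (r 1) = I \<and>
     (\<forall>k. mat_map (r (Suc k)) (r (Suc (Suc k))) (M (Suc k)) ` free_mod (r (Suc (Suc k))) =
          {v \<in> free_mod (r (Suc k)). mat_map (r k) (r (Suc k)) (M k) v = (\<lambda>_. 0)})"

text \<open>Projective dimension of \<open>R/I\<close>.  Free resolutions suffice over a local ring, where
  projective modules are free; the ring being Noetherian, their terms may be taken of finite
  rank.\<close>

definition quotient_projective_dimension :: "'a::comm_ring_1 set \<Rightarrow> enat" where
  "quotient_projective_dimension I = (INF n \<in> {n. \<exists>r M. finite_free_resolution I n r M}. enat n)"

definition perfect_ideal :: "'a::comm_ring_1 set \<Rightarrow> bool" where
  "perfect_ideal I \<longleftrightarrow> ideal I RR \<and> I \<noteq> UNIV \<and> grade I = quotient_projective_dimension I"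

definition colon_ideal :: "'a::comm_ring_1 set \<Rightarrow> 'a set \<Rightarrow> 'a set" where
  "colon_ideal K I = {r. \<forall>x\<in>I. r * x \<in> K}"

section \<open>Complexes of length three\<close>

text \<open>A triple \<open>(d\<^sub>1, d\<^sub>2, d\<^sub>3)\<close> stands for \<open>F\<^sub>3 \<rightarrow> F\<^sub>2 \<rightarrow> F\<^sub>1 \<rightarrow> R\<close> with \<open>F\<^sub>1 = R^'p\<close>, \<open>F\<^sub>2 = R^'q\<close>,
  \<open>F\<^sub>3 = R^'r\<close>; the linear form \<open>d\<^sub>1\<close> is a row vector.\<close>

type_synonym ('a, 'p, 'q, 'r) cplx3 = "('a^'p) \<times> ('a^'q^'p) \<times> ('a^'r^'q)"

definition free_resolution3 :: "'a::comm_ring_1 set \<Rightarrow> ('a, 'p::finite, 'q::finite, 'r::finite) cplx3 \<Rightarrow> bool" where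
  "free_resolution3 I F = (case F of (d1, d2, d3) \<Rightarrow>
     range (scalar_product d1) = I \<and>
     range ((*v) d2) = {v. scalar_product d1 v = 0} \<and>
     range ((*v) d3) = {v. d2 *v v = 0} \<and>
     inj ((*v) d3))"

definition minimal_free_resolution3 ::
  "'a::comm_ring_1 set \<Rightarrow> 'a set \<Rightarrow> ('a, 'p::finite, 'q::finite, 'r::finite) cplx3 \<Rightarrow> bool" where
  "minimal_free_resolution3 m I F \<longleftrightarrow> free_resolution3 I F \<and> (case F of (d1, d2, d3) \<Rightarrow>
     (\<forall>i. d1 $ i \<in> m) \<and> (\<forall>i j. d2 $ i $ j \<in> m) \<and> (\<forall>i j. d3 $ i $ j \<in> m))"

section \<open>Multilinear algebra of free modules in coordinates\<close>

text \<open>Coordinate models, all of the form \<open>R^'x\<close>: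
  \<^item> \<open>F \<otimes> G\<close> for \<open>F = R^'n\<close>, \<open>G = R^'m\<close> is \<open>R^('n \<times> 'm)\<close>;
  \<^item> \<open>S\<^sub>2 F\<close> is \<open>R^('n uprod)\<close>, with basis the monomials of degree two;
  \<^item> \<open>\<And>\<^sup>2 F\<close> is the module of alternating tensors in \<open>F \<otimes> F\<close>, with \<open>u \<and> v\<close> identified with
    \<open>u \<otimes> v - v \<otimes> u\<close> (an isomorphism for free \<open>F\<close> over any ring); the coefficient of
    \<open>e\<^sub>i \<and> e\<^sub>j\<close>, \<open>i < j\<close>, is the \<open>(i, j)\<close> entry.  Likewise \<open>\<And>\<^sup>2 F \<otimes> G\<close> sits in \<open>(F \<otimes> F) \<otimes> G\<close>.
  A linear map on \<open>\<And>\<^sup>k F\<close> is an alternating \<open>k\<close>-linear map, here on lists of length \<open>k\<close>.\<close>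

instance uprod :: (finite) finite
proof
  have "(UNIV :: 'a uprod set) = range (\<lambda>(a, b). Upair a b)"
    by (auto intro: uprod_exhaust simp: image_iff) (metis uprod_exhaust)
  then show "finite (UNIV :: 'a uprod set)"
    by (metis finite finite_imageI)
qed

abbreviation linear_map :: "('a::comm_ring_1^'n \<Rightarrow> 'a^'m) \<Rightarrow> bool" where
  "linear_map \<equiv> Modules.module_hom (*s) (*s)"

definition alternating_map :: "nat \<Rightarrow> (('a::comm_ring_1^'n) list \<Rightarrow> 'a^'m) \<Rightarrow> bool" where
  "alternating_map k w \<longleftrightarrow>
     (\<forall>xs i. length xs = k \<and> i < k \<longrightarrow> linear_map (\<lambda>v. w (xs[i := v]))) \<and>
     (\<forall>xs i j. length xs = k \<and> i < j \<and> j < k \<and> xs ! i = xs ! j \<longrightarrow> w xs = 0)"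

text \<open>The standard basis, numbered from 1.  For a numeral index type \<open>n\<close> the number \<open>i\<close> is taken
  modulo \<open>n\<close>, so \<open>std 1, \<dots>, std n\<close> is the basis.\<close>

definition std :: "nat \<Rightarrow> 'a::comm_ring_1 ^ 'n::{finite, comm_ring_1}" where
  "std i = axis (of_nat i) 1"

definition tensor :: "'a::comm_ring_1^'n::finite \<Rightarrow> 'a^'m::finite \<Rightarrow> 'a^('n \<times> 'm)" where
  "tensor v w = (\<chi> p. v $ fst p * w $ snd p)"

definition tensor_swap :: "'a::comm_ring_1^('n::finite \<times> 'm::finite) \<Rightarrow> 'a^('m \<times> 'n)" where
  "tensor_swap T = (\<chi> p. T $ (snd p, fst p))"

definition sym_prod :: "'a::comm_ring_1^'n::finite \<Rightarrow> 'a^'n \<Rightarrow> 'a^('n uprod)" where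
  "sym_prod v w = (\<Sum>i\<in>UNIV. \<Sum>j\<in>UNIV. (v $ i * w $ j) *s axis (Upair i j) 1)"

definition wedge2 :: "'a::comm_ring_1^'n::finite \<Rightarrow> 'a^'n \<Rightarrow> 'a^('n \<times> 'n)" where
  "wedge2 v w = (\<chi> p. v $ fst p * w $ snd p - v $ snd p * w $ fst p)"

definition ext2 :: "('a::comm_ring_1^('n::finite \<times> 'n)) set" where
  "ext2 = {T. \<forall>i j. T $ (i, i) = 0 \<and> T $ (j, i) = - (T $ (i, j))}"

definition ext2_tensor :: "('a::comm_ring_1^(('n::finite \<times> 'n) \<times> 'm::finite)) set" where
  "ext2_tensor = {T. \<forall>i j k. T $ ((i, i), k) = 0 \<and> T $ ((j, i), k) = - (T $ ((i, j), k))}"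

text \<open>The linear map on \<open>F \<otimes> G\<close>, \<open>\<And>\<^sup>2 F\<close>, \<open>S\<^sub>2 F\<close>, \<open>\<And>\<^sup>2 F \<otimes> G\<close> induced by a bilinear, alternating,
  symmetric, respectively alternating-times-linear map \<open>\<phi>\<close>, by linear extension from the standard
  basis; their values on decomposable elements are computed in \<open>tensor_map_tensor\<close>,
  \<open>ext2_map_wedge2\<close>, \<open>sym2_map_sym_prod\<close> and \<open>ext2_tensor_map_wedge2\<close> below.  On alternating and on
  symmetric tensors the choice of the linear order on the index type is immaterial (in a numeral
  type \<open>n\<close> the element \<open>n = 0\<close> comes first).\<close>

definition tensor_map ::
  "('a::comm_ring_1^'n::finite \<Rightarrow> 'a^'m::finite \<Rightarrow> 'a^'k) \<Rightarrow> 'a^('n \<times> 'm) \<Rightarrow> 'a^'k" where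
  "tensor_map \<phi> T = (\<Sum>i\<in>UNIV. \<Sum>j\<in>UNIV. T $ (i, j) *s \<phi> (axis i 1) (axis j 1))"

definition ext2_map ::
  "('a::comm_ring_1^'n::{finite, linorder} \<Rightarrow> 'a^'n::{finite, linorder} \<Rightarrow> 'a^'k) \<Rightarrow> 'a^('n \<times> 'n) \<Rightarrow> 'a^'k" where
  "ext2_map \<phi> T = (\<Sum>i\<in>UNIV. \<Sum>j\<in>{i<..}. T $ (i, j) *s \<phi> (axis i 1) (axis j 1))"

definition sym2_map ::
  "('a::comm_ring_1^'n::{finite, linorder} \<Rightarrow> 'a^'n::{finite, linorder} \<Rightarrow> 'a^'k) \<Rightarrow> 'a^('n uprod) \<Rightarrow> 'a^'k" where
  "sym2_map \<phi> T = (\<Sum>i\<in>UNIV. \<Sum>j\<in>{i..}. T $ Upair i j *s \<phi> (axis i 1) (axis j 1))"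

definition ext2_tensor_map ::
  "('a::comm_ring_1^'n::{finite, linorder} \<Rightarrow> 'a^'n::{finite, linorder} \<Rightarrow> 'a^'m::finite \<Rightarrow> 'a^'k) \<Rightarrow>
     'a^(('n \<times> 'n) \<times> 'm) \<Rightarrow> 'a^'k" where
  "ext2_tensor_map \<phi> T =
     (\<Sum>i\<in>UNIV. \<Sum>j\<in>{i<..}. \<Sum>k\<in>UNIV. T $ ((i, j), k) *s \<phi> (axis i 1) (axis j 1) (axis k 1))"

text \<open>Pairings of \<open>\<And>\<^sup>2 F\<close> with \<open>\<gamma> \<and> \<gamma>'\<close> and of \<open>\<And>\<^sup>2 F \<otimes> G\<close> with \<open>\<gamma> \<and> \<gamma>' \<otimes> \<delta>\<close>, by
  determinants.  Dual modules are identified with coordinate modules by means of the dual bases,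
  so that evaluation is the scalar product.\<close>

definition ext2_pairing ::
  "'a::comm_ring_1^('n::{finite, linorder} \<times> 'n) \<Rightarrow> 'a^'n::{finite, linorder} \<Rightarrow> 'a^'n::{finite, linorder} \<Rightarrow> 'a" where
  "ext2_pairing T \<gamma> \<gamma>' =
     (\<Sum>i\<in>UNIV. \<Sum>j\<in>{i<..}. T $ (i, j) * (\<gamma> $ i * \<gamma>' $ j - \<gamma> $ j * \<gamma>' $ i))"

definition ext2_tensor_pairing ::
  "'a::comm_ring_1^(('n::{finite, linorder} \<times> 'n) \<times> 'm::finite) \<Rightarrow> 'a^'n::{finite, linorder} \<Rightarrow> 'a^'n::{finite, linorder} \<Rightarrow> 'a^'m \<Rightarrow> 'a" where
  "ext2_tensor_pairing T \<gamma> \<gamma>' \<delta> =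
     (\<Sum>i\<in>UNIV. \<Sum>j\<in>{i<..}. \<Sum>k\<in>UNIV.
        T $ ((i, j), k) * ((\<gamma> $ i * \<gamma>' $ j - \<gamma> $ j * \<gamma>' $ i) * \<delta> $ k))"

text \<open>Meaningful only when 2 is a unit.\<close>

definition half :: "'a::comm_ring_1" where
  "half = (THE c. 2 * c = 1)"

lemma linear_map_add: "linear_map f \<Longrightarrow> f (v + w) = f v + f w"
  by (simp add: Modules.module_hom_def Modules.module_hom_axioms_def)

lemma linear_map_scale: "linear_map f \<Longrightarrow> f (c *s v) = c *s f v"
  by (simp add: Modules.module_hom_def Modules.module_hom_axioms_def)

lemma linear_map_expand:
  fixes f :: "'a::comm_ring_1^'n \<Rightarrow> 'a^'m"
  assumes "linear_map f"
  shows "f v = (\<Sum>i\<in>UNIV. v $ i *s f (axis i 1))"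
proof -
  have "f (\<Sum>i\<in>A. c i *s b i) = (\<Sum>i\<in>A. c i *s f (b i))" if "finite A" for A :: "'n set" and c b
    using that
  proof induction
    case empty
    show ?case using linear_map_scale[OF assms, of 0 0] by simp
  qed (simp add: linear_map_add[OF assms] linear_map_scale[OF assms])
  from this[of UNIV "\<lambda>i. v $ i" "\<lambda>i. axis i 1"] show ?thesis
    by (simp add: basis_expansion)
qed

lemma vec_scale_sum: "c *s (\<Sum>i\<in>A. f i) = (\<Sum>i\<in>A. c *s f i :: 'a::comm_ring_1^'n)"
  by (simp add: vec_eq_iff sum_distrib_left)

lemma bilinear_expand:
  fixes \<phi> :: "'a::comm_ring_1^'n \<Rightarrow> 'a^'m \<Rightarrow> 'a^'k"
  assumes "\<And>v. linear_map (\<phi> v)" "\<And>w. linear_map (\<lambda>v. \<phi> v w)"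
  shows "\<phi> v w = (\<Sum>i\<in>UNIV. \<Sum>j\<in>UNIV. (v $ i * w $ j) *s \<phi> (axis i 1) (axis j 1))"
proof -
  have "\<phi> v w = (\<Sum>i\<in>UNIV. v $ i *s \<phi> (axis i 1) w)"
    by (rule linear_map_expand) (rule assms)
  also have "\<dots> = (\<Sum>i\<in>UNIV. v $ i *s (\<Sum>j\<in>UNIV. w $ j *s \<phi> (axis i 1) (axis j 1)))"
    by (rule sum.cong[OF refl], subst linear_map_expand[OF assms(1)], rule refl)
  finally show ?thesis
    by (simp add: vec_scale_sum vector_smult_assoc)
qed

lemma tensor_map_tensor:
  fixes \<phi> :: "'a::comm_ring_1^'n \<Rightarrow> 'a^'m \<Rightarrow> 'a^'k"
  assumes "\<And>v. linear_map (\<phi> v)" "\<And>w. linear_map (\<lambda>v. \<phi> v w)"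
  shows "tensor_map \<phi> (tensor v w) = \<phi> v w"
  by (simp add: tensor_map_def tensor_def bilinear_expand[OF assms, of v w])

lemma sum_UNIV_split:
  fixes g :: "'n::{finite, linorder} \<Rightarrow> 'n \<Rightarrow> 'b::comm_monoid_add"
  shows "(\<Sum>i\<in>UNIV. \<Sum>j\<in>UNIV. g i j) =
    (\<Sum>i\<in>UNIV. \<Sum>j\<in>{i<..}. g i j + g j i) + (\<Sum>i\<in>UNIV. g i i)"
proof -
  have split: "(\<Sum>j\<in>UNIV. g i j) = (\<Sum>j\<in>{i<..}. g i j) + (\<Sum>j\<in>{..<i}. g i j) + g i i" for i
  proof -
    have "(UNIV :: 'n set) = insert i ({i<..} \<union> {..<i})" by auto
    then have "(\<Sum>j\<in>UNIV. g i j) = g i i + (\<Sum>j\<in>{i<..} \<union> {..<i}. g i j)"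
      by (metis (no_types, lifting) Un_iff finite greaterThan_iff lessThan_iff
          order_less_irrefl sum.insert)
    also have "(\<Sum>j\<in>{i<..} \<union> {..<i}. g i j) = (\<Sum>j\<in>{i<..}. g i j) + (\<Sum>j\<in>{..<i}. g i j)"
      by (rule sum.union_disjoint) auto
    finally show ?thesis by (simp add: ac_simps)
  qed
  have "(\<Sum>i\<in>UNIV. \<Sum>j\<in>{..<i}. g i j) = (\<Sum>j\<in>UNIV. \<Sum>i\<in>{j<..}. g i j)"
    using sum.swap_restrict[of UNIV UNIV g "\<lambda>i j. j < i"]
    by (simp add: lessThan_def greaterThan_def)
  then show ?thesis
    by (simp add: split sum.distrib)
qed

lemma ext2_map_wedge2:
  fixes \<phi> :: "'a::comm_ring_1^'n::{finite, linorder} \<Rightarrow> 'a^'n::{finite, linorder} \<Rightarrow> 'a^'k"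
  assumes lin: "\<And>v. linear_map (\<phi> v)" "\<And>w. linear_map (\<lambda>v. \<phi> v w)"
    and alt: "\<And>v. \<phi> v v = 0"
  shows "ext2_map \<phi> (wedge2 v w) = \<phi> v w"
proof -
  have skew: "\<phi> b a = - \<phi> a b" for a b
  proof -
    have "\<phi> (a + b) (a + b) = \<phi> a a + \<phi> a b + (\<phi> b a + \<phi> b b)"
      by (simp add: linear_map_add[OF lin(1)] linear_map_add[OF lin(2)])
    then show ?thesis
      by (simp add: alt add_eq_0_iff)
  qed
  have "\<phi> v w = (\<Sum>i\<in>UNIV. \<Sum>j\<in>{i<..}.
      (v $ i * w $ j) *s \<phi> (axis i 1) (axis j 1) + (v $ j * w $ i) *s \<phi> (axis j 1) (axis i 1))"
    by (subst bilinear_expand[OF lin]) (simp add: sum_UNIV_split alt)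
  also have "\<dots> = ext2_map \<phi> (wedge2 v w)"
    unfolding ext2_map_def wedge2_def
  proof (intro sum.cong refl)
    fix i j
    show "(v $ i * w $ j) *s \<phi> (axis i 1) (axis j 1) + (v $ j * w $ i) *s \<phi> (axis j 1) (axis i 1) =
      (\<chi> p. v $ fst p * w $ snd p - v $ snd p * w $ fst p) $ (i, j) *s \<phi> (axis i 1) (axis j 1)"
      by (subst skew[of "axis j 1"]) (simp add: vec_eq_iff algebra_simps)
  qed
  finally show ?thesis ..
qed

lemma sym_prod_nth:
  fixes v w :: "'a::comm_ring_1^'n"
  shows "sym_prod v w $ Upair i j =
    (if i = j then v $ i * w $ i else v $ i * w $ j + v $ j * w $ i)"
proof -
  have "sym_prod v w $ Upair i j =
      (\<Sum>(k, l)\<in>UNIV \<times> UNIV. if Upair k l = Upair i j then v $ k * w $ l else 0)"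
    unfolding sym_prod_def sum.cartesian_product[symmetric]
    by (simp add: axis_def if_distrib cong: if_cong)
       (intro sum.cong refl, auto)
  also have "\<dots> = (\<Sum>(k, l)\<in>{(i, j), (j, i)}. v $ k * w $ l)"
    by (rule sum.mono_neutral_cong_right) (auto split: if_splits)
  finally show ?thesis by auto
qed

lemma sym2_map_sym_prod:
  fixes \<phi> :: "'a::comm_ring_1^'n::{finite, linorder} \<Rightarrow> 'a^'n::{finite, linorder} \<Rightarrow> 'a^'k"
  assumes lin: "\<And>v. linear_map (\<phi> v)" "\<And>w. linear_map (\<lambda>v. \<phi> v w)"
    and sym: "\<And>v w. \<phi> v w = \<phi> w v"
  shows "sym2_map \<phi> (sym_prod v w) = \<phi> v w"
proof -
  define b where "b i j = \<phi> (axis i 1) (axis j 1)" for i j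
  have b_sym: "b j i = b i j" for i j
    unfolding b_def by (rule sym)
  have ins: "{i..} = insert i {i<..}" for i :: 'n
    by auto
  have "sym2_map \<phi> (sym_prod v w) =
      (\<Sum>i\<in>UNIV. (v $ i * w $ i) *s b i i + (\<Sum>j\<in>{i<..}. (v $ i * w $ j + v $ j * w $ i) *s b i j))"
    unfolding sym2_map_def ins b_def
    by (intro sum.cong refl) (auto simp: sym_prod_nth intro!: sum.cong)
  also have "\<dots> = (\<Sum>i\<in>UNIV. \<Sum>j\<in>{i<..}. (v $ i * w $ j) *s b i j + (v $ j * w $ i) *s b j i)
      + (\<Sum>i\<in>UNIV. (v $ i * w $ i) *s b i i)"
    by (subst (2) b_sym) (simp add: sum.distrib vector_sadd_rdistrib ac_simps)
  also have "\<dots> = \<phi> v w"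
    by (subst bilinear_expand[OF lin, of v w]) (simp add: sum_UNIV_split b_def)
  finally show ?thesis .
qed

lemma wedge2_in_ext2: "wedge2 v w \<in> ext2"
  by (simp add: ext2_def wedge2_def)

lemma ext2_tensor_map_wedge2:
  fixes \<phi> :: "'a::comm_ring_1^'n::{finite, linorder} \<Rightarrow> 'a^'n::{finite, linorder} \<Rightarrow> 'a^'m \<Rightarrow> 'a^'k"
  assumes "\<And>v z. linear_map (\<lambda>w. \<phi> v w z)" "\<And>w z. linear_map (\<lambda>v. \<phi> v w z)"
    "\<And>v w. linear_map (\<phi> v w)" and "\<And>v z. \<phi> v v z = 0"
  shows "ext2_tensor_map \<phi> (tensor (wedge2 v w) z) = \<phi> v w z"
proof -
  have "\<phi> v w z = ext2_map (\<lambda>v w. \<phi> v w z) (wedge2 v w)"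
    by (rule ext2_map_wedge2[symmetric]) (use assms in auto)
  also have "\<dots> = ext2_tensor_map \<phi> (tensor (wedge2 v w) z)"
    unfolding ext2_map_def ext2_tensor_map_def tensor_def
    by (intro sum.cong refl, subst linear_map_expand[OF assms(3)])
       (simp add: vec_scale_sum vector_smult_assoc)
  finally show ?thesis ..
qed

lemma ext2_pairing_wedge2:
  "ext2_pairing (wedge2 v w) \<gamma> \<gamma>' =
     scalar_product v \<gamma> * scalar_product w \<gamma>' - scalar_product v \<gamma>' * scalar_product w \<gamma>"
proof -
  have "scalar_product v \<gamma> * scalar_product w \<gamma>' - scalar_product v \<gamma>' * scalar_product w \<gamma> =
      (\<Sum>i\<in>UNIV. \<Sum>j\<in>UNIV. v $ i * w $ j * (\<gamma> $ i * \<gamma>' $ j - \<gamma>' $ i * \<gamma> $ j))"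
    unfolding scalar_product_def sum_product sum_subtractf[symmetric]
    by (intro sum.cong refl) (simp add: algebra_simps)
  also have "\<dots> = ext2_pairing (wedge2 v w) \<gamma> \<gamma>'"
    by (simp add: sum_UNIV_split ext2_pairing_def wedge2_def algebra_simps)
  finally show ?thesis ..
qed

section \<open>Structure maps\<close>

definition is_w31 ::
  "('a::comm_ring_1, 'p::finite, 'q::finite, 'r::finite) cplx3 \<Rightarrow> (('a^'p) list \<Rightarrow> 'a^'q) \<Rightarrow> bool" where
  "is_w31 F w31 = (case F of (d1, d2, d3) \<Rightarrow> alternating_map 2 w31 \<and>
     (\<forall>x y. d2 *v w31 [x, y] = scalar_product d1 x *s y - scalar_product d1 y *s x))"

definition is_w21 ::
  "('a::comm_ring_1, 'p::finite, 'q::finite, 'r::finite) cplx3 \<Rightarrow> (('a^'p) list \<Rightarrow> 'a^'q) \<Rightarrow>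
     ('a^'p \<Rightarrow> 'a^'q \<Rightarrow> 'a^'r) \<Rightarrow> bool" where
  "is_w21 F w31 w21 = (case F of (d1, d2, d3) \<Rightarrow>
     (\<forall>x. linear_map (w21 x)) \<and> (\<forall>f. linear_map (\<lambda>x. w21 x f)) \<and>
     (\<forall>x f. d3 *v w21 x f = scalar_product d1 x *s f - w31 [x, d2 *v f]))"

definition is_w11 ::
  "('a::comm_ring_1, 'p::finite, 'q::finite, 'r::finite) cplx3 \<Rightarrow> (('a^'p) list \<Rightarrow> 'a^'q) \<Rightarrow>
     (('a^'p) list \<Rightarrow> 'a^'r) \<Rightarrow> bool" where
  "is_w11 F w31 w11 = (case F of (d1, d2, d3) \<Rightarrow> alternating_map 3 w11 \<and>
     (\<forall>x y z. d3 *v w11 [x, y, z] =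
        scalar_product d1 x *s w31 [y, z] - scalar_product d1 y *s w31 [x, z]
        + scalar_product d1 z *s w31 [x, y]))"

definition is_w32 ::
  "('a::comm_ring_1, 'p::finite, 'q::finite, 'r::finite) cplx3 \<Rightarrow> (('a^'p) list \<Rightarrow> 'a^'q) \<Rightarrow>
     (('a^'p) list \<Rightarrow> 'a^('r \<times> 'q)) \<Rightarrow> bool" where
  "is_w32 F w31 w32 = (case F of (d1, d2, d3) \<Rightarrow> alternating_map 4 w32 \<and>
     (\<forall>x y z t. tensor_map (\<lambda>g f. sym_prod (d3 *v g) f) (w32 [x, y, z, t]) =
        sym_prod (w31 [x, y]) (w31 [z, t]) - sym_prod (w31 [x, z]) (w31 [y, t])
        + sym_prod (w31 [x, t]) (w31 [y, z])))"

definition is_w22 ::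
  "('a::comm_ring_1, 'p::finite, 'q::finite, 'r::{finite, linorder}) cplx3 \<Rightarrow>
     (('a^'p) list \<Rightarrow> 'a^'q) \<Rightarrow> ('a^'p \<Rightarrow> 'a^'q \<Rightarrow> 'a^'r::{finite, linorder}) \<Rightarrow> (('a^'p) list \<Rightarrow> 'a^'r::{finite, linorder}) \<Rightarrow>
     (('a^'p) list \<Rightarrow> 'a^('r \<times> 'q)) \<Rightarrow> (('a^'p) list \<Rightarrow> 'a^'q \<Rightarrow> 'a^('r \<times> 'r)) \<Rightarrow> bool" where
  "is_w22 F w31 w21 w11 w32 w22 = (case F of (d1, d2, d3) \<Rightarrow>
     (\<forall>f. alternating_map 3 (\<lambda>xs. w22 xs f)) \<and>
     (\<forall>xs. length xs = 3 \<longrightarrow> linear_map (w22 xs)) \<and>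
     (\<forall>xs f. length xs = 3 \<longrightarrow> w22 xs f \<in> ext2) \<and>
     (\<forall>x y z f. ext2_map (\<lambda>g g'. tensor (d3 *v g) g' - tensor (d3 *v g') g) (w22 [x, y, z] f) =
        tensor (w31 [x, y]) (w21 z f) - tensor (w31 [x, z]) (w21 y f)
        + tensor (w31 [y, z]) (w21 x f) + tensor_swap (w32 [x, y, z, d2 *v f])
        - tensor f (w11 [x, y, z])))"

text \<open>In the remaining structure maps \<open>ys\<close> is an ordered basis \<open>[y\<^sub>1, \<dots>, y\<^sub>5]\<close> of \<open>F\<^sub>1\<close>; \<open>nth1 ys i\<close> is
  \<open>y\<^sub>i\<close> and \<open>omit i ys\<close> lists the other ones in increasing order.\<close>

definition nth1 :: "'b list \<Rightarrow> nat \<Rightarrow> 'b" where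
  "nth1 ys i = ys ! (i - 1)"

definition omit :: "nat \<Rightarrow> 'b list \<Rightarrow> 'b list" where
  "omit i ys = take (i - 1) ys @ drop i ys"

definition is_w122 ::
  "('a::comm_ring_1, 'p::finite, 'q::finite, 'r::{finite, linorder}) cplx3 \<Rightarrow>
     (('a^'p) list \<Rightarrow> 'a^'q) \<Rightarrow> (('a^'p) list \<Rightarrow> 'a^'r::{finite, linorder}) \<Rightarrow> ('a^'p) list \<Rightarrow>
     (('a^'p) list \<Rightarrow> 'a^('r uprod)) \<Rightarrow> bool" where
  "is_w122 F w31 w11 ys w122 = (case F of (d1, d2, d3) \<Rightarrow> alternating_map 5 w122 \<and>
     sym2_map (\<lambda>g g'. half *s (tensor (d3 *v g) g' + tensor (d3 *v g') g)) (w122 ys) =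
       (\<Sum>i\<in>{1..5}. \<Sum>j\<in>{i<..5}. (-1) ^ (i + j + 1) *s
          tensor (w31 [nth1 ys i, nth1 ys j]) (w11 (omit i (omit j ys)))))"

definition is_w23 ::
  "('a::comm_ring_1, 'p::finite, 'q::finite, 'r::{finite, linorder}) cplx3 \<Rightarrow>
     ('a^'p \<Rightarrow> 'a^'q \<Rightarrow> 'a^'r::{finite, linorder}) \<Rightarrow> (('a^'p) list \<Rightarrow> 'a^('r \<times> 'q)) \<Rightarrow>
     (('a^'p) list \<Rightarrow> 'a^('r uprod)) \<Rightarrow> ('a^'p) list \<Rightarrow>
     (('a^'p) list \<Rightarrow> 'a^'q \<Rightarrow> 'a^(('r \<times> 'r) \<times> 'r)) \<Rightarrow> bool" where
  "is_w23 F w21 w32 w122 ys w23 = (case F of (d1, d2, d3) \<Rightarrow>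
     (\<forall>f. alternating_map 5 (\<lambda>xs. w23 xs f)) \<and>
     (\<forall>xs. length xs = 5 \<longrightarrow> linear_map (w23 xs)) \<and>
     (\<forall>xs f. length xs = 5 \<longrightarrow> w23 xs f \<in> ext2_tensor) \<and>
     (\<forall>f. ext2_tensor_map (\<lambda>a b c. tensor (sym_prod c b) (d3 *v a) - tensor (sym_prod c a) (d3 *v b))
            (w23 ys f) =
        (\<Sum>i\<in>{1..5}. (-1) ^ (i + 1) *s
           tensor_map (\<lambda>g' f'. tensor (sym_prod (w21 (nth1 ys i) f) g') f') (w32 (omit i ys)))
        - half *s tensor (w122 ys) f))"

definition is_w33 ::
  "('a::comm_ring_1, 'p::finite, 'q::finite, 'r::{finite, linorder}) cplx3 \<Rightarrow>
     (('a^'p) list \<Rightarrow> 'a^'q) \<Rightarrow> (('a^'p) list \<Rightarrow> 'a^('r \<times> 'q)) \<Rightarrow> ('a^'p) list \<Rightarrow>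
     (('a^'p) list \<Rightarrow> 'a^'p \<Rightarrow> 'a^(('r \<times> 'r) \<times> 'q)) \<Rightarrow> bool" where
  "is_w33 F w31 w32 ys w33 = (case F of (d1, d2, d3) \<Rightarrow>
     (\<forall>y. alternating_map 5 (\<lambda>xs. w33 xs y)) \<and>
     (\<forall>xs. length xs = 5 \<longrightarrow> linear_map (w33 xs)) \<and>
     (\<forall>xs y. length xs = 5 \<longrightarrow> w33 xs y \<in> ext2_tensor) \<and>
     (\<forall>k\<in>{1..5}.
        ext2_tensor_map
          (\<lambda>g g' f. tensor g (sym_prod (d3 *v g') f) - tensor g' (sym_prod (d3 *v g) f))
          (w33 ys (nth1 ys k)) =
        (\<Sum>i\<in>{1..5} - {k}. (-1) ^ (i + 1) *s
           tensor_map (\<lambda>g f. tensor g (sym_prod f (w31 [nth1 ys k, nth1 ys i]))) (w32 (omit i ys)))))"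

section \<open>The mapping cone\<close>

text \<open>Matrix of the Koszul differential \<open>b\<^sub>2 : B\<^sub>2 \<rightarrow> B\<^sub>1\<close> on \<open>x\<^sub>1, x\<^sub>2, x\<^sub>3\<close>; the listed vectors are
  the images of \<open>t\<^sub>1, t\<^sub>2, t\<^sub>3\<close>.  They come from \<open>b\<^sub>2(s\<^sub>i s\<^sub>j) = x\<^sub>i s\<^sub>j - x\<^sub>j s\<^sub>i\<close> and the products
  \<open>s\<^sub>1 s\<^sub>2 = t\<^sub>3\<close>, \<open>s\<^sub>1 s\<^sub>3 = - t\<^sub>2\<close>, \<open>s\<^sub>2 s\<^sub>3 = t\<^sub>1\<close>.\<close>

definition koszul_b2 :: "'a::comm_ring_1^3 \<Rightarrow> 'a^3^3" where
  "koszul_b2 x = transpose (vector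
     [x $ 2 *s std 3 - x $ 3 *s std 2,
      x $ 3 *s std 1 - x $ 1 *s std 3,
      x $ 1 *s std 2 - x $ 2 *s std 1])"

lemma mult_axis_nth:
  fixes A :: "'a::comm_ring_1^'n^'m"
  shows "(A *v axis k 1) $ i = A $ i $ k"
  by (simp add: matrix_vector_mult_def axis_def if_distrib cong: if_cong)

lemma koszul_b2_std:
  "koszul_b2 x *v std 1 = x $ 2 *s std 3 - x $ 3 *s std 2"
  "koszul_b2 x *v std 2 = x $ 3 *s std 1 - x $ 1 *s std 3"
  "koszul_b2 x *v std 3 = x $ 1 *s std 2 - x $ 2 *s std 1"
  by (simp_all add: koszul_b2_def std_def vec_eq_iff mult_axis_nth transpose_def vector_3
      del: transpose_matrix_vector vector_transpose_matrix)

text \<open>\<open>u\<close> is the matrix of \<open>\<alpha>\<^sub>1 : B\<^sub>1 \<rightarrow> A\<^sub>1\<close>.  The columns of the matrix of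
  \<open>\<beta>\<^sub>2 : A\<^sub>2\<^sup>* \<rightarrow> B\<^sub>1\<close> belong to the \<open>\<phi>\<^sub>h\<close>, its rows (listed) to \<open>s\<^sub>1, s\<^sub>2, s\<^sub>3\<close>; \<open>\<beta>\<^sub>3\<close> is a row vector.\<close>

definition cone_beta1 :: "'a::comm_ring_1^3^'p \<Rightarrow> 'a^'p^3" where
  "cone_beta1 u = transpose u"

definition cone_beta2 ::
  "'a::comm_ring_1^3^'p \<Rightarrow> (('a^'p) list \<Rightarrow> 'a^'q) \<Rightarrow> 'a^'q^3" where
  "cone_beta2 u w31 = vector
     [w31 [u *v std 2, u *v std 3], - w31 [u *v std 1, u *v std 3], w31 [u *v std 1, u *v std 2]]"

definition cone_beta3 ::
  "'a::comm_ring_1^3^'p \<Rightarrow> (('a^'p) list \<Rightarrow> 'a^'r) \<Rightarrow> 'a^'r" where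
  "cone_beta3 u w11 = w11 [u *v std 1, u *v std 2, u *v std 3]"

text \<open>\<open>D\<^sub>1 = A\<^sub>3\<^sup>* \<oplus> B\<^sub>1\<close> and \<open>D\<^sub>2 = A\<^sub>2\<^sup>* \<oplus> B\<^sub>2\<close> are coordinate modules over sum types.\<close>

definition mapping_cone ::
  "('a::comm_ring_1, 'p::finite, 'q::finite, 'r::finite) cplx3 \<Rightarrow> 'a^3 \<Rightarrow> 'a^3^'p \<Rightarrow>
     (('a^'p) list \<Rightarrow> 'a^'q) \<Rightarrow> (('a^'p) list \<Rightarrow> 'a^'r) \<Rightarrow>
     ('a, 'r + 3, 'q + 3, 'p) cplx3" where
  "mapping_cone A x u w31 w11 = (case A of (a1, a2, a3) \<Rightarrow>
     (\<chi> c. case c of Inl v \<Rightarrow> cone_beta3 u w11 $ v | Inr j \<Rightarrow> x $ j,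
      \<chi> r c. (case r of
          Inl v \<Rightarrow> (case c of Inl h \<Rightarrow> transpose a3 $ v $ h | Inr k \<Rightarrow> 0)
        | Inr j \<Rightarrow> (case c of Inl h \<Rightarrow> - (cone_beta2 u w31 $ j $ h)
                              | Inr k \<Rightarrow> - (koszul_b2 x $ j $ k))),
      \<chi> r c. (case r of Inl h \<Rightarrow> transpose a2 $ h $ c | Inr j \<Rightarrow> cone_beta1 u $ j $ c)))"

text \<open>Basis vectors of the two summands of \<open>D\<^sub>1\<close> (namely \<open>\<gamma>\<^sub>v\<close>, \<open>s\<^sub>j\<close>) and of \<open>D\<^sub>2\<close>
  (namely \<open>\<phi>\<^sub>h\<close>, \<open>t\<^sub>k\<close>).\<close>

definition std_l :: "nat \<Rightarrow> 'a::comm_ring_1 ^ ('n::{finite, comm_ring_1} + 'k::finite)" where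
  "std_l i = axis (Inl (of_nat i)) 1"

definition std_r :: "nat \<Rightarrow> 'a::comm_ring_1 ^ ('k::finite + 'n::{finite, comm_ring_1})" where
  "std_r i = axis (Inr (of_nat i)) 1"

definition cone_w31 ::
  "'a::comm_ring_1^3^5 \<Rightarrow> ('a^5 \<Rightarrow> 'a^6 \<Rightarrow> 'a^2) \<Rightarrow> (('a^5) list \<Rightarrow> 'a^6 \<Rightarrow> 'a^(2 \<times> 2)) \<Rightarrow>
     (('a^(2 + 3)) list \<Rightarrow> 'a^(6 + 3)) \<Rightarrow> bool" where
  "cone_w31 u w21 w22 W31 \<longleftrightarrow> alternating_map 2 W31 \<and>
     (\<forall>i j k. {i, j, k} = {1, 2, 3} \<and> i < j \<longrightarrow>
        W31 [std_r i, std_r j] = (-1) ^ (i + j) *s std_r k) \<and>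
     (\<forall>i\<in>{1..3}. \<forall>t\<in>{1..2}.
        W31 [std_r i, std_l t] =
          (\<Sum>h\<in>{1..6}. scalar_product (w21 (u *v std i) (std h)) (std t) *s std_l h)) \<and>
     W31 [std_l 1, std_l 2] =
       (\<Sum>h\<in>{1..6}. ext2_pairing (w22 [u *v std 1, u *v std 2, u *v std 3] (std h)) (std 1) (std 2)
          *s std_l h)"

definition cone_w32 ::
  "'a::comm_ring_1^3^5 \<Rightarrow> ('a^5 \<Rightarrow> 'a^6 \<Rightarrow> 'a^2) \<Rightarrow> (('a^5) list \<Rightarrow> 'a^6 \<Rightarrow> 'a^(2 \<times> 2)) \<Rightarrow>
     (('a^(2 + 3)) list \<Rightarrow> 'a^(5 \<times> (6 + 3))) \<Rightarrow> bool" where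
  "cone_w32 u w21 w22 W32 \<longleftrightarrow> alternating_map 4 W32 \<and>
     (\<forall>v\<in>{1..2}.
        W32 [std_l v, std_r 1, std_r 2, std_r 3] =
          (\<Sum>i\<in>{1..5}. \<Sum>h\<in>{1..6}. scalar_product (w21 (std i) (std h)) (std v) *s
             tensor (std i) (std_l h))) \<and>
     (\<forall>p\<in>{1..3}. \<forall>q\<in>{p<..3}.
        W32 [std_l 1, std_l 2, std_r p, std_r q] =
          - (\<Sum>i\<in>{1..5}. \<Sum>h\<in>{1..6}.
               ext2_pairing (w22 [std i, u *v std p, u *v std q] (std h)) (std 1) (std 2) *s
                 tensor (std i) (std_l h)))"

end

theory Submission
  imports Defs
begin

text \<open>The theorem is an identity in \<open>D\<^sub>3 \<otimes> S\<^sub>2 D\<^sub>2\<close> for each of the five basis vectors \<open>y\<close> of \<open>D\<^sub>1\<close>.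
Elements of \<open>D\<^sub>3 \<otimes> S\<^sub>2 D\<^sub>2 = A\<^sub>1\<^sup>* \<otimes> S\<^sub>2 (A\<^sub>2\<^sup>* \<oplus> B\<^sub>2)\<close> can be evaluated at \<open>e \<in> A\<^sub>1\<close> and at
\<open>(f, \<tau>) \<in> A\<^sub>2 \<oplus> B\<^sub>2\<^sup>*\<close>, quadratically in the latter, and an element is determined by its values
(\<open>quad_eval_eqI\<close>).  If \<open>C(e, e', f)\<close> is the trilinear form, alternating in \<open>e, e'\<close>, whose
coefficients define \<open>w\<^sup>(\<^sup>3\<^sup>)\<^sub>3(\<epsilon> \<otimes> y)\<close>, then the image of \<open>w\<^sup>(\<^sup>3\<^sup>)\<^sub>3(\<epsilon> \<otimes> y)\<close> under the map along which it has
to be a lift takes the value \<open>C(e, a\<^sub>2 f + \<alpha>\<^sub>1 \<tau>, f)\<close>, because the transpose of the differential \<open>d\<^sub>3\<close>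
of the cone is \<open>(f, \<tau>) \<mapsto> a\<^sub>2 f + \<alpha>\<^sub>1 \<tau>\<close> (\<open>eval_cone_lift\<close>).  The other side of the identity
evaluates to explicit products of values of structure maps of \<open>\<bbbA>\<close>.

The terms linear in \<open>\<tau>\<close> agree by the alternation of \<open>w\<^sup>(\<^sup>2\<^sup>)\<^sub>2\<close> and \<open>w\<^sup>(\<^sup>2\<^sup>)\<^sub>3\<close>.  The terms free of \<open>\<tau>\<close> say
what the two maps do when one of their arguments in \<open>A\<^sub>1\<close> is the boundary \<open>z = a\<^sub>2 f\<close> of their argument
in \<open>A\<^sub>2\<close>:
\<^item> \<open>w\<^sup>(\<^sup>2\<^sup>)\<^sub>2(x \<and> y \<and> z \<otimes> f) = (x \<cdot> f) \<and> (y \<cdot> f)\<close> for the vectors \<open>s\<^sub>j\<close> (\<open>pair22_boundary\<close>);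
\<^item> \<open>w\<^sup>(\<^sup>2\<^sup>)\<^sub>3(z \<and> x\<^sub>0 \<and> \<dots> \<and> x\<^sub>3 \<otimes> f)\<close> is the alternating sum of \<open>w\<^sup>(\<^sup>2\<^sup>)\<^sub>2(x\<^sub>0 \<and> \<dots> (omit x\<^sub>i) \<dots> \<and> x\<^sub>3 \<otimes> f) \<otimes> x\<^sub>i \<cdot> f\<close>
  for the vectors \<open>\<gamma>\<^sub>u\<close> (\<open>pair23_boundary\<close>).

Both are identities in \<open>\<bbbA>\<close> between elements of modules that embed by maps built from the injective
\<open>a\<^sub>3\<close>, so it suffices to compare images, which the defining equations of the structure maps give.
In the first identity everything but \<open>x \<cdot> f\<close>, \<open>y \<cdot> f\<close> drops out since \<open>z \<cdot> f = 0\<close> and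
\<open>x \<cdot> y \<cdot> z = a\<^sub>1(y) (x \<cdot> f) - a\<^sub>1(x) (y \<cdot> f)\<close>.  In the second, the products of two factors \<open>x\<^sub>i \<cdot> f\<close>
cancel by symmetry, the terms with \<open>w\<^sup>(\<^sup>3\<^sup>)\<^sub>2\<close> match, and what is left is the formula
\<open>w\<^sup>(\<^sup>1\<^sup>)\<^sub>2\<^sub>,\<^sub>2(z \<and> x\<^sub>0 \<and> \<dots> \<and> x\<^sub>3) = 2 \<Sum> \<plusminus> (x\<^sub>i \<cdot> f) (x\<^sub>j \<cdot> x\<^sub>k \<cdot> x\<^sub>l)\<close> in \<open>S\<^sub>2 A\<^sub>3\<close> (\<open>w122_boundary\<close>), which is proved
in the same way.  Here 2 must be invertible; it is, being outside the maximal ideal of a local ring.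

The structure maps \<open>w\<^sup>(\<^sup>1\<^sup>)\<^sub>2\<^sub>,\<^sub>2\<close> and \<open>w\<^sup>(\<^sup>2\<^sup>)\<^sub>3\<close> are specified on one basis of \<open>A\<^sub>1\<close> only, while the argument
needs them on tuples containing \<open>a\<^sub>2 f\<close>.  As both sides of their defining equations are alternating
and \<open>A\<^sub>1\<close> has rank 5, agreement on one basis implies agreement everywhere
(\<open>alternating_map_eqI\<close>, \<open>shuffle14_alternating\<close>, \<open>shuffle23_alternating\<close>).\<close>

section \<open>Alternating maps\<close>

lemma linear_mapI:
  fixes f :: "'a::comm_ring_1^'n \<Rightarrow> 'a^'m"
  assumes "\<And>v w. f (v + w) = f v + f w" "\<And>c v. f (c *s v) = c *s f v"
  shows "linear_map f"
  using assms
  by (simp add: Modules.module_hom_def Modules.module_hom_axioms_def Modules.module_def vec_eq_iff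
      algebra_simps)

lemma alternating_map_linear:
  "alternating_map k w \<Longrightarrow> length xs = k \<Longrightarrow> i < k \<Longrightarrow> linear_map (\<lambda>v. w (xs[i := v]))"
  by (simp add: alternating_map_def)

lemma alternating_map_vanish:
  "alternating_map k w \<Longrightarrow> length xs = k \<Longrightarrow> i < j \<Longrightarrow> j < k \<Longrightarrow> xs ! i = xs ! j \<Longrightarrow> w xs = 0"
  unfolding alternating_map_def by blast

text \<open>Polarization of the vanishing condition in the two slots \<open>i\<close>, \<open>j\<close> alone.  It is stated for one
fixed pair of slots so that it serves both adjacent slots, before \<open>w\<close> is known to be alternating, and
arbitrary slots afterwards.\<close>

lemma swap_neg_of_vanishing:
  assumes lin: "\<And>xs i. length xs = k \<Longrightarrow> i < k \<Longrightarrow> linear_map (\<lambda>v. w (xs[i := v]))"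
    and "length xs = k" "i < k" "j < k" "i \<noteq> j"
    and van: "\<And>c. w (xs[i := c, j := c]) = 0"
  shows "w (xs[i := a, j := b]) = - w (xs[i := b, j := a])"
proof -
  have addj: "w (xs[i := p, j := q + r]) = w (xs[i := p, j := q]) + w (xs[i := p, j := r])" for p q r
    using linear_map_add[OF lin[of "xs[i := p]" j]] assms(2-5) by simp
  have addi: "w (xs[i := p + q, j := r]) = w (xs[i := p, j := r]) + w (xs[i := q, j := r])" for p q r
    using linear_map_add[OF lin[of "xs[j := r]" i], of p q] assms(2-5)
    by (simp add: list_update_swap)
  have "0 = w (xs[i := a + b, j := a + b])"
    by (simp add: van)
  also have "\<dots> = w (xs[i := a, j := b]) + w (xs[i := b, j := a])"
    by (simp only: addi addj) (simp add: van)
  finally show ?thesis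
    by (metis eq_neg_iff_add_eq_0)
qed

text \<open>Two equal entries can be moved next to each other by adjacent transpositions, each of which only
changes the sign.\<close>

lemma alternating_mapI_adjacent:
  assumes lin: "\<And>xs i. length xs = k \<Longrightarrow> i < k \<Longrightarrow> linear_map (\<lambda>v. w (xs[i := v]))"
    and adj: "\<And>xs i. length xs = k \<Longrightarrow> Suc i < k \<Longrightarrow> xs ! i = xs ! Suc i \<Longrightarrow> w xs = 0"
  shows "alternating_map k w"
proof -
  have "w xs = 0" if "length xs = k" "i < j" "j < k" "xs ! i = xs ! j" for xs i j
    using that
  proof (induction j arbitrary: xs)
    case (Suc j)
    show ?case
    proof (cases "i = j")
      case True
      then show ?thesis using adj Suc.prems by blast
    next
      case False
      have "w (xs[j := xs ! j, Suc j := xs ! Suc j]) = - w (xs[j := xs ! Suc j, Suc j := xs ! j])"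
        by (rule swap_neg_of_vanishing[OF lin]) (use Suc.prems in \<open>auto intro!: adj[of _ j]\<close>)
      moreover have "w (xs[j := xs ! Suc j, Suc j := xs ! j]) = 0"
        by (rule Suc.IH) (use Suc.prems False in auto)
      ultimately show ?thesis by simp
    qed
  qed simp
  then show ?thesis
    using lin by (auto simp: alternating_map_def)
qed

lemma alternating_map_swap:
  assumes "alternating_map k w" "length xs = k" "i < k" "j < k" "i \<noteq> j"
  shows "w (xs[i := xs ! j, j := xs ! i]) = - w xs"
proof -
  have "w (xs[i := c, j := c]) = 0" for c
    using alternating_map_vanish[OF assms(1), of "xs[i := c, j := c]" i j]
      alternating_map_vanish[OF assms(1), of "xs[i := c, j := c]" j i] assms(2-5)
    by (cases i j rule: linorder_cases) auto
  then have "w (xs[i := xs ! j, j := xs ! i]) = - w (xs[i := xs ! i, j := xs ! j])"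
    by (intro swap_neg_of_vanishing[where k = k] alternating_map_linear[OF assms(1)] assms(2-5))
  then show ?thesis by simp
qed

lemma permute_list_transpose:
  assumes "i < length xs" "j < length xs"
  shows "permute_list (Transposition.transpose i j) xs = xs[i := xs ! j, j := xs ! i]"
  by (rule nth_equalityI)
    (use assms in \<open>auto simp: permute_list_def Transposition.transpose_def nth_list_update\<close>)

text \<open>An alternating map on \<open>\<And>\<^sup>k F\<close> with \<open>k\<close> the rank of \<open>F\<close> is its value on one basis times a
determinant.  This is stated for an arbitrary submodule \<open>S\<close> instead of with a determinant: multilinearity
reduces to lists of basis vectors, where the map vanishes or is, by transpositions, the value on
the given basis up to sign.\<close>

lemma alternating_map_mem_of_basis:
  fixes w :: "('a::comm_ring_1^'n) list \<Rightarrow> 'a^'m" and ns :: "'n list"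
  assumes alt: "alternating_map k w"
    and ns: "length ns = k" "distinct ns" "set ns = UNIV"
    and S: "0 \<in> S" "\<And>v w. v \<in> S \<Longrightarrow> w \<in> S \<Longrightarrow> v + w \<in> S" "\<And>c v. v \<in> S \<Longrightarrow> c *s v \<in> S"
    and base: "w (map (\<lambda>i. axis i 1) ns) \<in> S"
    and xs: "length xs = k"
  shows "w xs \<in> S"
proof -
  have neg: "- v \<in> S" if "v \<in> S" for v
    using S(3)[OF that, of "- 1"] by (metis vector_sneg_minus1)
  have lin: "linear_map (\<lambda>v. w (xs[i := v]))" if "length xs = k" "i < k" for xs i
    using alt that by (simp add: alternating_map_def)
  have basis: "w (map (\<lambda>i. axis i 1) ms) \<in> S" if ms: "length ms = k" for ms :: "'n list"
  proof (cases "distinct ms")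
    case False
    then obtain i j where "i < j" "j < k" "ms ! i = ms ! j"
      using ms by (metis distinct_conv_nth linorder_neqE_nat)
    then have "w (map (\<lambda>i. axis i 1) ms) = 0"
      using alt ms by (simp add: alternating_map_def) (metis length_map nth_map order.strict_trans)
    then show ?thesis by (simp add: S)
  next
    case True
    then have "set ms = set ns"
      using ns ms by (metis card_subset_eq distinct_card finite_set subset_UNIV)
    then have "mset ms = mset ns"
      using True ns set_eq_iff_mset_eq_distinct by blast
    then obtain p where p: "p permutes {..<k}" "permute_list p ns = ms"
      using mset_eq_permutation ns by metis
    have "w (map (\<lambda>i. axis i 1) (permute_list p ns)) \<in> S"
      using finite_lessThan p(1)
    proof (induction p rule: permutes_rev_induct)
      case id
      then show ?case using base by simp
    next
      case (swap i j p)
      let ?zs = "map (\<lambda>i. axis i (1::'a)) (permute_list p ns)"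
      have ij: "i < k" "j < k" using swap by auto
      have "Transposition.transpose i j permutes {..<k}"
        using ij by (simp add: permutes_swap_id)
      then have "permute_list (p \<circ> Transposition.transpose i j) ns =
          permute_list (Transposition.transpose i j) (permute_list p ns)"
        by (intro permute_list_compose) (simp add: ns)
      then have "map (\<lambda>i. axis i (1::'a)) (permute_list (p \<circ> Transposition.transpose i j) ns)
          = ?zs[i := ?zs ! j, j := ?zs ! i]"
        using ij ns by (simp add: permute_list_transpose map_update)
      moreover have "w (?zs[i := ?zs ! j, j := ?zs ! i]) = - w ?zs"
        by (rule alternating_map_swap[OF alt]) (use ij ns swap in auto)
      ultimately show ?case using neg[OF swap.IH] by metis
    qed
    then show ?thesis using p by simp
  qed
  have Ssum: "(\<Sum>i\<in>A. f i) \<in> S" if "finite A" "\<And>i. f i \<in> S" for A :: "'n set" and f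
    using that by (induction rule: finite_induct) (auto simp: S)
  \<comment> \<open>Expand the first \<open>n\<close> entries one after the other; the others are basis vectors already.\<close>
  have *: "w xs \<in> S" if "length xs = k" "n \<le> k"
    "\<And>i. n \<le> i \<Longrightarrow> i < k \<Longrightarrow> xs ! i \<in> range (\<lambda>j. axis j 1)"
    for n xs
    using that
  proof (induction n arbitrary: xs)
    case 0
    then have "\<forall>i<k. \<exists>j. xs ! i = axis j 1" by auto
    then obtain m where m: "\<And>i. i < k \<Longrightarrow> xs ! i = axis (m i) 1" by metis
    have "xs = map (\<lambda>i. axis i 1) (map m [0..<k])"
      by (rule nth_equalityI) (use 0 m in auto)
    moreover have "w (map (\<lambda>i. axis i 1) (map m [0..<k])) \<in> S"
      by (rule basis) simp
    ultimately show ?case by simp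
  next
    case (Suc n)
    have "w (xs[n := xs ! n]) = (\<Sum>i\<in>UNIV. xs ! n $ i *s w (xs[n := axis i 1]))"
      by (rule linear_map_expand, rule lin) (use Suc.prems in auto)
    moreover have "w (xs[n := axis i 1]) \<in> S" for i
      by (rule Suc.IH) (use Suc.prems in \<open>auto simp: nth_list_update\<close>)
    ultimately show ?case
      using S(3) Ssum by simp
  qed
  show ?thesis using *[of xs k] by (simp add: xs)
qed

lemma alternating_map_diff:
  assumes "alternating_map k w" "alternating_map k w'"
  shows "alternating_map k (\<lambda>xs. w xs - w' xs)"
proof -
  have "linear_map (\<lambda>v. w (xs[i := v]) - w' (xs[i := v]))" if "length xs = k" "i < k" for xs i
    using linear_map_add[OF alternating_map_linear[OF assms(1) that]]
      linear_map_add[OF alternating_map_linear[OF assms(2) that]]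
      linear_map_scale[OF alternating_map_linear[OF assms(1) that]]
      linear_map_scale[OF alternating_map_linear[OF assms(2) that]]
    by (intro linear_mapI) (simp_all add: vector_ssub_ldistrib)
  then show ?thesis
    using assms[THEN alternating_map_vanish] unfolding alternating_map_def by auto
qed

lemma alternating_map_eqI:
  fixes w w' :: "('a::comm_ring_1^'n) list \<Rightarrow> 'a^'m" and ns :: "'n list"
  assumes "alternating_map k w" "alternating_map k w'"
    and "length ns = k" "distinct ns" "set ns = UNIV"
    and "w (map (\<lambda>i. axis i 1) ns) = w' (map (\<lambda>i. axis i 1) ns)"
    and "length xs = k"
  shows "w xs = w' xs"
  using alternating_map_mem_of_basis[OF alternating_map_diff[OF assms(1,2)] assms(3-5), of "{0}" xs]
    assms(6,7) by simp

lemma alternating_map_2D: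
  assumes "alternating_map 2 w"
  shows "linear_map (\<lambda>v. w [v, b])" "linear_map (\<lambda>v. w [a, v])" "w [a, a] = 0"
  using alternating_map_linear[OF assms, of "[a, b]" 0] alternating_map_linear[OF assms, of "[a, b]" 1]
    alternating_map_vanish[OF assms, of "[a, a]" 0 1] by simp_all

lemma alternating_map_3D:
  assumes "alternating_map 3 w"
  shows "linear_map (\<lambda>v. w [v, b, c])" "linear_map (\<lambda>v. w [a, v, c])"
    "linear_map (\<lambda>v. w [a, b, v])" "w [a, a, c] = 0" "w [a, b, b] = 0"
  using alternating_map_linear[OF assms, of "[a, b, c]" 0]
    alternating_map_linear[OF assms, of "[a, b, c]" 1]
    alternating_map_linear[OF assms, of "[a, b, c]" 2]
    alternating_map_vanish[OF assms, of "[a, a, c]" 0 1]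
    alternating_map_vanish[OF assms, of "[a, b, b]" 1 2] by simp_all

lemma alternating_map_4D:
  assumes "alternating_map 4 w"
  shows "linear_map (\<lambda>v. w [v, b, c, d])" "linear_map (\<lambda>v. w [a, v, c, d])"
    "linear_map (\<lambda>v. w [a, b, v, d])" "linear_map (\<lambda>v. w [a, b, c, v])"
    "w [a, a, c, d] = 0" "w [a, b, b, d] = 0" "w [a, b, c, c] = 0"
  using alternating_map_linear[OF assms, of "[a, b, c, d]" 0]
    alternating_map_linear[OF assms, of "[a, b, c, d]" 1]
    alternating_map_linear[OF assms, of "[a, b, c, d]" 2]
    alternating_map_linear[OF assms, of "[a, b, c, d]" 3]
    alternating_map_vanish[OF assms, of "[a, a, c, d]" 0 1]
    alternating_map_vanish[OF assms, of "[a, b, b, d]" 1 2]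
    alternating_map_vanish[OF assms, of "[a, b, c, c]" 2 3] by simp_all

lemma alternating_map_comp:
  assumes "linear_map L" "alternating_map k w"
  shows "alternating_map k (\<lambda>xs. L (w xs))"
proof -
  have "L 0 = 0" using linear_map_scale[OF assms(1), of 0 0] by simp
  moreover have "linear_map (\<lambda>v. L (w (xs[i := v])))" if "length xs = k" "i < k" for xs i
    using linear_map_add[OF alternating_map_linear[OF assms(2) that]]
      linear_map_scale[OF alternating_map_linear[OF assms(2) that]]
    by (intro linear_mapI) (simp_all add: linear_map_add[OF assms(1)] linear_map_scale[OF assms(1)])
  ultimately show ?thesis
    using alternating_map_vanish[OF assms(2)] unfolding alternating_map_def by auto
qed

lemma basis_5:
  "[std 1, std 2, std 3, std 4, std 5 :: 'a::comm_ring_1^5] = map (\<lambda>i. axis i 1) [1, 2, 3, 4, 5]"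
  "distinct [1, 2, 3, 4, 5 :: 5]" "set [1, 2, 3, 4, 5 :: 5] = UNIV"
proof -
  show d: "distinct [1, 2, 3, 4, 5 :: 5]" by simp
  have "card (set [1, 2, 3, 4, 5 :: 5]) = CARD(5)"
    by (subst distinct_card[OF d]) simp
  then show "set [1, 2, 3, 4, 5 :: 5] = UNIV"
    by (intro card_subset_eq) auto
  show "[std 1, std 2, std 3, std 4, std 5 :: 'a::comm_ring_1^5] = map (\<lambda>i. axis i 1) [1, 2, 3, 4, 5]"
    by (simp add: std_def)
qed

lemma alternating_map_eq_of_std:
  fixes w w' :: "('a::comm_ring_1^5) list \<Rightarrow> 'a^'m"
  assumes "alternating_map 5 w" "alternating_map 5 w'" "length xs = 5"
    and "w [std 1, std 2, std 3, std 4, std 5] = w' [std 1, std 2, std 3, std 4, std 5]"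
  shows "w xs = w' xs"
  by (rule alternating_map_eqI[OF assms(1,2) _ basis_5(2,3) _ assms(3)])
    (use assms(4) in \<open>simp_all only: basis_5(1)[symmetric], simp\<close>)

section \<open>Shuffle products of alternating maps\<close>

text \<open>Up to the identification of alternating maps with linear maps on exterior powers, these are the
shuffle product of a linear form with a map on \<open>\<And>\<^sup>4\<close> and that of a form on \<open>\<And>\<^sup>3\<close> with a map on \<open>\<And>\<^sup>2\<close>.
The first occurs in the equation for \<open>w\<^sup>(\<^sup>2\<^sup>)\<^sub>3\<close>, the second in that for \<open>w\<^sup>(\<^sup>1\<^sup>)\<^sub>2\<^sub>,\<^sub>2\<close>.\<close>

definition shuffle14 :: "('v \<Rightarrow> 'a::comm_ring_1) \<Rightarrow> ('v list \<Rightarrow> 'a^'m) \<Rightarrow> 'v list \<Rightarrow> 'a^'m" where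
  "shuffle14 p Q ys = (\<Sum>i\<in>{1..5}. (-1) ^ (i + 1) *s (p (nth1 ys i) *s Q (omit i ys)))"

definition shuffle23 :: "('v list \<Rightarrow> 'a^'m) \<Rightarrow> ('v list \<Rightarrow> 'a::comm_ring_1) \<Rightarrow> 'v list \<Rightarrow> 'a^'m" where
  "shuffle23 A b ys = (\<Sum>i\<in>{1..5}. \<Sum>j\<in>{i<..5}. (-1) ^ (i + j + 1) *s
     (b (omit i (omit j ys)) *s A [nth1 ys i, nth1 ys j]))"

lemma sum_1_5: "(\<Sum>i\<in>{1..5::nat}. f i) = f 1 + f 2 + f 3 + f 4 + f 5"
  by (simp add: numeral_eq_Suc atLeastAtMostSuc_conv add.assoc add.commute add.left_commute)

lemma sum_pairs_1_5: "(\<Sum>i\<in>{1..5::nat}. \<Sum>j\<in>{i<..5}. f i j) =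
  f 1 2 + f 1 3 + f 1 4 + f 1 5 + f 2 3 + f 2 4 + f 2 5 + f 3 4 + f 3 5 + f 4 5"
proof -
  have "{1<..5::nat} = {2,3,4,5}" "{2<..5::nat} = {3,4,5}" "{3<..5::nat} = {4,5}" "{4<..5::nat} = {5}"
    by auto
  then show ?thesis unfolding sum_1_5 by (simp add: add.assoc)
qed

lemma nth1_5:
  "nth1 [a, b, c, d, e] 1 = a" "nth1 [a, b, c, d, e] 2 = b" "nth1 [a, b, c, d, e] 3 = c"
  "nth1 [a, b, c, d, e] 4 = d" "nth1 [a, b, c, d, e] 5 = e"
  by (simp_all add: nth1_def)

lemma omit_5:
  "omit 1 [a, b, c, d, e] = [b, c, d, e]" "omit 2 [a, b, c, d, e] = [a, c, d, e]"
  "omit 3 [a, b, c, d, e] = [a, b, d, e]" "omit 4 [a, b, c, d, e] = [a, b, c, e]"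
  "omit 5 [a, b, c, d, e] = [a, b, c, d]"
  by (simp_all add: omit_def)

lemma omit_4:
  "omit 1 [a, b, c, d] = [b, c, d]" "omit 2 [a, b, c, d] = [a, c, d]"
  "omit 3 [a, b, c, d] = [a, b, d]" "omit 4 [a, b, c, d] = [a, b, c]"
  by (simp_all add: omit_def)

lemma alternating_signs:
  "(-1 :: 'a::comm_ring_1) ^ (1 + 1) = 1" "(-1 :: 'a) ^ (2 + 1) = -1" "(-1 :: 'a) ^ (3 + 1) = 1"
  "(-1 :: 'a) ^ (4 + 1) = -1" "(-1 :: 'a) ^ (5 + 1) = 1"
  by simp_all

lemma shuffle14_expand:
  "shuffle14 p Q [a, b, c, d, e] = p a *s Q [b, c, d, e] - p b *s Q [a, c, d, e] +
     p c *s Q [a, b, d, e] - p d *s Q [a, b, c, e] + p e *s Q [a, b, c, d]"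
  unfolding shuffle14_def sum_1_5 alternating_signs nth1_5 omit_5 by (simp add: vec_eq_iff)

lemma shuffle23_expand:
  "shuffle23 A h [a, b, c, d, e] =
     h [c, d, e] *s A [a, b] - h [b, d, e] *s A [a, c] + h [b, c, e] *s A [a, d]
     - h [b, c, d] *s A [a, e] + h [a, d, e] *s A [b, c] - h [a, c, e] *s A [b, d]
     + h [a, c, d] *s A [b, e] + h [a, b, e] *s A [c, d] - h [a, b, d] *s A [c, e]
     + h [a, b, c] *s A [d, e]"
  unfolding shuffle23_def sum_pairs_1_5 nth1_5 omit_5 omit_4 by (simp add: vec_eq_iff)

lemma list5_cases:
  assumes "length xs = 5"
  obtains a b c d e where "xs = [a, b, c, d, e]"
  using assms by (auto simp: numeral_eq_Suc length_Suc_conv)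

lemma alternating_map_5I:
  fixes w :: "('a::comm_ring_1^'n) list \<Rightarrow> 'a^'m"
  assumes lin: "\<And>a b c d e. linear_map (\<lambda>v. w [v, b, c, d, e])"
    "\<And>a b c d e. linear_map (\<lambda>v. w [a, v, c, d, e])"
    "\<And>a b c d e. linear_map (\<lambda>v. w [a, b, v, d, e])"
    "\<And>a b c d e. linear_map (\<lambda>v. w [a, b, c, v, e])"
    "\<And>a b c d e. linear_map (\<lambda>v. w [a, b, c, d, v])"
    and van: "\<And>a c d e. w [a, a, c, d, e] = 0" "\<And>a b d e. w [a, b, b, d, e] = 0"
    "\<And>a b c e. w [a, b, c, c, e] = 0" "\<And>a b c d. w [a, b, c, d, d] = 0"
  shows "alternating_map 5 w"
proof (rule alternating_mapI_adjacent)
  fix xs :: "('a^'n) list" and i :: nat assume "length xs = 5" and i: "i < 5"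
  then obtain a b c d e where xs: "xs = [a, b, c, d, e]" using list5_cases by metis
  have "i = 0 \<or> i = 1 \<or> i = 2 \<or> i = 3 \<or> i = 4" using i by auto
  then show "linear_map (\<lambda>v. w (xs[i := v]))"
    using lin by (auto simp: xs)
next
  fix xs :: "('a^'n) list" and i :: nat assume "length xs = 5" and i: "Suc i < 5" "xs ! i = xs ! Suc i"
  then obtain a b c d e where xs: "xs = [a, b, c, d, e]" using list5_cases by metis
  have "i = 0 \<or> i = 1 \<or> i = 2 \<or> i = 3" using i by auto
  then show "w xs = 0"
    using van i(2) by (auto simp: xs)
qed

lemma shuffle14_alternating:
  fixes L :: "'a::comm_ring_1^'n \<Rightarrow> 'a^'k" and Q :: "('a^'n) list \<Rightarrow> 'a^'m"
  assumes L: "linear_map L" and Q: "alternating_map 4 Q"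
  shows "alternating_map 5 (shuffle14 (\<lambda>y. L y $ v) Q)"
proof -
  note Q' = alternating_map_4D[OF Q]
  note rules = shuffle14_expand linear_map_add[OF L] linear_map_scale[OF L] Q'(5-7)
    Q'(1-4)[THEN linear_map_add] Q'(1-4)[THEN linear_map_scale]
  show ?thesis
    by (rule alternating_map_5I; (rule linear_mapI)?)
      (simp_all add: rules, simp_all add: vec_eq_iff algebra_simps)
qed

lemma shuffle23_alternating:
  fixes A :: "('a::comm_ring_1^'n) list \<Rightarrow> 'a^'m" and B :: "('a^'n) list \<Rightarrow> 'a^'k"
  assumes A: "alternating_map 2 A" and B: "alternating_map 3 B"
  shows "alternating_map 5 (shuffle23 A (\<lambda>ys. B ys $ v))"
proof -
  note A' = alternating_map_2D[OF A]
  note B' = alternating_map_3D[OF B]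
  note rules = shuffle23_expand A'(1,2)[THEN linear_map_add] A'(1,2)[THEN linear_map_scale]
    B'(1-3)[THEN linear_map_add] B'(1-3)[THEN linear_map_scale] A'(3) B'(4,5)
  show ?thesis
    by (rule alternating_map_5I; (rule linear_mapI)?)
      (simp_all add: rules, simp_all add: vec_eq_iff algebra_simps)
qed

lemma sum_1_5_remove:
  "(\<Sum>i\<in>{1..5::nat} - {1}. f i) = f 2 + f 3 + f 4 + f 5"
  "(\<Sum>i\<in>{1..5::nat} - {2}. f i) = f 1 + f 3 + f 4 + f 5"
  "(\<Sum>i\<in>{1..5::nat} - {3}. f i) = f 1 + f 2 + f 4 + f 5"
  "(\<Sum>i\<in>{1..5::nat} - {4}. f i) = f 1 + f 2 + f 3 + f 5"
  "(\<Sum>i\<in>{1..5::nat} - {5}. f i) = f 1 + f 2 + f 3 + f 4"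
proof -
  have "{1..5::nat} - {1} = {2,3,4,5}" "{1..5::nat} - {2} = {1,3,4,5}" "{1..5::nat} - {3} = {1,2,4,5}"
    "{1..5::nat} - {4} = {1,2,3,5}" "{1..5::nat} - {5} = {1,2,3,4}" by auto
  then show
    "(\<Sum>i\<in>{1..5::nat} - {1}. f i) = f 2 + f 3 + f 4 + f 5"
    "(\<Sum>i\<in>{1..5::nat} - {2}. f i) = f 1 + f 3 + f 4 + f 5"
    "(\<Sum>i\<in>{1..5::nat} - {3}. f i) = f 1 + f 2 + f 4 + f 5"
    "(\<Sum>i\<in>{1..5::nat} - {4}. f i) = f 1 + f 2 + f 3 + f 5"
    "(\<Sum>i\<in>{1..5::nat} - {5}. f i) = f 1 + f 2 + f 3 + f 4"
    by (simp_all add: add.assoc)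
qed

section \<open>Linear forms, tensors and quadratic forms in coordinates\<close>

lemma axis_nth_if: "axis i c $ j = (if j = i then c else 0)"
  by (simp add: axis_def)

lemma matrix_vector_mult_add: "(A::'a::comm_ring_1^'n^'m) *v (v + w) = A *v v + A *v w"
  by (simp add: matrix_vector_right_distrib)
lemma matrix_vector_mult_scale: "(A::'a::comm_ring_1^'n^'m) *v (c *s w) = c *s (A *v w)"
  by (simp add: vec_eq_iff matrix_vector_mult_def sum_distrib_left mult.left_commute)
lemma matrix_vector_mult_linear: "linear_map ((*v) (A::'a::comm_ring_1^'n^'m))"
  by (intro linear_mapI matrix_vector_mult_add matrix_vector_mult_scale)

definition linear_form :: "('a::comm_ring_1^'n \<Rightarrow> 'a) \<Rightarrow> bool" where
  "linear_form L \<longleftrightarrow> (\<forall>v w. L (v + w) = L v + L w) \<and> (\<forall>c v. L (c *s v) = c * L v)"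

lemma linear_form_comp:
  assumes "linear_map L" "linear_form F" shows "linear_form (\<lambda>x. F (L x))"
  using assms by (simp add: linear_form_def linear_map_add[OF assms(1)] linear_map_scale[OF assms(1)])

lemma linear_form_component: "linear_form (\<lambda>w :: 'a::comm_ring_1^'n. w $ v)"
  by (simp add: linear_form_def)

lemma linear_form_expand:
  assumes "linear_form L"
  shows "L v = (\<Sum>i\<in>UNIV. L (axis i 1) * v $ i)"
proof -
  \<comment> \<open>View \<open>L\<close> as a map to the module \<open>R^1\<close>.\<close>
  have "linear_map (\<lambda>v. (\<chi> j::1. L v))"
    using assms by (intro linear_mapI) (simp_all add: linear_form_def vec_eq_iff)
  from linear_map_expand[OF this, of v] show ?thesis
    by (simp add: vec_eq_iff mult.commute)
qed

lemma sum_UNIV_5: "(\<Sum>i\<in>(UNIV :: 5 set). f i) = f 1 + f 2 + f 3 + f 4 + f 5"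
proof -
  have d: "distinct [1, 2, 3, 4, 5 :: 5]" by simp
  have "card (set [1, 2, 3, 4, 5 :: 5]) = CARD(5)"
    by (subst distinct_card[OF d]) simp
  then have u: "UNIV = set [1, 2, 3, 4, 5 :: 5]"
    by (intro card_subset_eq[symmetric]) auto
  show ?thesis
    unfolding u sum.distinct_set_conv_list[OF d] by (simp add: add.assoc)
qed

lemma sum_UNIV_6: "(\<Sum>i\<in>(UNIV :: 6 set). f i) = f 1 + f 2 + f 3 + f 4 + f 5 + f 6"
proof -
  have d: "distinct [1, 2, 3, 4, 5, 6 :: 6]" by simp
  have "card (set [1, 2, 3, 4, 5, 6 :: 6]) = CARD(6)"
    by (subst distinct_card[OF d]) simp
  then have u: "UNIV = set [1, 2, 3, 4, 5, 6 :: 6]"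
    by (intro card_subset_eq[symmetric]) auto
  show ?thesis
    unfolding u sum.distinct_set_conv_list[OF d] by (simp add: add.assoc)
qed

lemma sum_1_6: "(\<Sum>i\<in>{1..6::nat}. f i) = f 1 + f 2 + f 3 + f 4 + f 5 + f 6"
  by (simp add: numeral_eq_Suc atLeastAtMostSuc_conv add.assoc add.commute add.left_commute)

lemma linear_form_std_5:
  assumes "linear_form L"
  shows "(\<Sum>i\<in>{1..5}. L (std i) * v $ of_nat i) = L (v :: 'a::comm_ring_1^5)"
  unfolding sum_1_5 by (subst linear_form_expand[OF assms]) (simp add: sum_UNIV_5 std_def)

lemma linear_form_std_6:
  assumes "linear_form L"
  shows "(\<Sum>i\<in>{1..6}. L (std i) * v $ of_nat i) = L (v :: 'a::comm_ring_1^6)"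
  unfolding sum_1_6 by (subst linear_form_expand[OF assms]) (simp add: sum_UNIV_6 std_def)

text \<open>The sum over \<open>i < k\<close> is the pairing of \<open>C\<close>, as an element of \<open>\<And>\<^sup>2\<close> of the dual module, with \<open>v \<and> w\<close>
by determinants.\<close>

lemma alternating_form_std_5:
  fixes C :: "'a::comm_ring_1^5 \<Rightarrow> 'a^5 \<Rightarrow> 'a"
  assumes lin: "\<And>w. linear_form (\<lambda>v. C v w)" "\<And>v. linear_form (C v)" and alt: "\<And>v. C v v = 0"
  shows "(\<Sum>i\<in>{1..5}. \<Sum>k\<in>{i<..5}.
    C (std i) (std k) * (v $ of_nat i * w $ of_nat k - v $ of_nat k * w $ of_nat i)) = C v w"
proof -
  have skew: "C b a = - C a b" for a b
  proof -
    have "C (a + b) (a + b) = C a a + C a b + (C b a + C b b)"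
      using lin by (simp add: linear_form_def)
    then show ?thesis by (simp add: alt add_eq_0_iff)
  qed
  have "C v w = (\<Sum>i\<in>{1..5}. (\<Sum>k\<in>{1..5}. C (std i) (std k) * w $ of_nat k) * v $ of_nat i)"
    by (simp only: linear_form_std_5[OF lin(2)] linear_form_std_5[OF lin(1)])
  also have "\<dots> = (\<Sum>i\<in>{1..5}. \<Sum>k\<in>{i<..5}.
    C (std i) (std k) * (v $ of_nat i * w $ of_nat k - v $ of_nat k * w $ of_nat i))"
    unfolding sum_pairs_1_5 unfolding sum_1_5 alt
      skew[of "std 1" "std 2"] skew[of "std 1" "std 3"] skew[of "std 1" "std 4"] skew[of "std 1" "std 5"]
      skew[of "std 2" "std 3"] skew[of "std 2" "std 4"] skew[of "std 2" "std 5"]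
      skew[of "std 3" "std 4"] skew[of "std 3" "std 5"] skew[of "std 4" "std 5"]
    by (simp add: algebra_simps)
  finally show ?thesis by (rule sym)
qed

lemma scalar_product_linear:
  fixes v w z :: "'a::comm_ring_1^'n"
  shows "scalar_product (v + w) z = scalar_product v z + scalar_product w z"
  "scalar_product (c *s v) z = c * scalar_product v z" "scalar_product 0 z = 0"
  "scalar_product (- v) z = - scalar_product v z"
  by (simp_all add: scalar_product_def distrib_right sum.distrib sum_distrib_left mult.assoc
      sum_negf[symmetric] del: sum_negf)

lemma scalar_product_sum:
  fixes z :: "'a::comm_ring_1^'n"
  shows "scalar_product (\<Sum>i\<in>A. f i) z = (\<Sum>i\<in>A. scalar_product (f i) z)"
  by (induction A rule: infinite_finite_induct) (simp_all add: scalar_product_linear)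

lemma scalar_product_axis: "scalar_product (axis i 1) v = v $ i"
  by (simp add: scalar_product_def axis_nth_if if_distribR if_distrib cong: if_cong)

text \<open>Contraction of the first factor of \<open>F \<otimes> G\<close> with the dual basis vector of index \<open>v\<close>.\<close>

definition tensor_row :: "'r \<Rightarrow> 'a^('r::finite \<times> 'q::finite) \<Rightarrow> 'a^'q" where
  "tensor_row v T = (\<chi> h. T $ (v, h))"

lemma tensor_row_linear:
  fixes S T :: "'a::comm_ring_1^('r::finite \<times> 'n::finite)"
  shows "tensor_row e (S + T) = tensor_row e S + tensor_row e T"
    "tensor_row e (S - T) = tensor_row e S - tensor_row e T"
    "tensor_row e (c *s T) = c *s tensor_row e T"
    "tensor_row e (- T) = - tensor_row e T"
  by (simp_all add: tensor_row_def vec_eq_iff)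

lemma tensor_row_sum:
  fixes f :: "'i \<Rightarrow> 'a::comm_ring_1^('r::finite \<times> 'n::finite)"
  shows "tensor_row e (\<Sum>i\<in>A. f i) = (\<Sum>i\<in>A. tensor_row e (f i))"
  by (simp add: tensor_row_def vec_eq_iff)

lemma tensor_row_tensor: "tensor_row e (tensor v w) = v $ e *s w"
  by (simp add: tensor_row_def tensor_def vec_eq_iff)

lemma tensor_row_eqI: "(\<And>e. tensor_row e S = tensor_row e T) \<Longrightarrow> S = T"
  by (auto simp: tensor_row_def vec_eq_iff)

text \<open>The value at \<open>v\<close> of the monomial \<open>p\<close> of degree two in the coordinate functions.\<close>

definition monomial :: "'a::comm_ring_1^'n \<Rightarrow> 'n uprod \<Rightarrow> 'a" where
  "monomial v p = (THE c. \<forall>i j. p = Upair i j \<longrightarrow> c = v $ i * v $ j)"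

lemma monomial_Upair: "monomial v (Upair i j) = v $ i * v $ j"
  unfolding monomial_def by (rule the_equality) (auto simp: mult.commute)

definition quad_eval :: "'a::comm_ring_1^'n \<Rightarrow> 'a^('n uprod) \<Rightarrow> 'a" where
  "quad_eval v T = (\<Sum>p\<in>UNIV. T $ p * monomial v p)"

lemma quad_eval_linear: "quad_eval v (S + T) = quad_eval v S + quad_eval v T"
  "quad_eval v (c *s S) = c * quad_eval v S" "quad_eval v 0 = 0"
  "quad_eval v (S - T) = quad_eval v S - quad_eval v T"
  by (simp_all add: quad_eval_def distrib_right left_diff_distrib sum.distrib sum_subtractf
      sum_distrib_left mult.assoc)

lemma quad_eval_sum: "quad_eval v (\<Sum>i\<in>A. f i) = (\<Sum>i\<in>A. quad_eval v (f i))"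
  by (induction A rule: infinite_finite_induct) (simp_all add: quad_eval_linear)

lemma quad_eval_axis: "quad_eval v (axis p 1) = monomial v p"
  by (simp add: quad_eval_def axis_nth_if if_distribR if_distrib cong: if_cong)

lemma quad_eval_sym_prod: "quad_eval v (sym_prod a b) = scalar_product a v * scalar_product b v"
  unfolding sym_prod_def quad_eval_sum quad_eval_linear quad_eval_axis monomial_Upair scalar_product_def
    sum_product
  by (intro sum.cong refl) (simp add: mult_ac)

text \<open>A quadratic form is determined by its values, over any ring: the value at the \<open>i\<close>-th basis vector is the
coefficient of the \<open>i\<close>-th square, and the values at sums of two basis vectors then give the mixed
coefficients.\<close>

lemma quad_eval_eqI:
  assumes "\<And>v. quad_eval v S = quad_eval v T"
  shows "S = T"
proof -
  let ?D = "S - T"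
  have z: "quad_eval v ?D = 0" for v
    using assms by (simp add: quad_eval_linear)
  have diag: "?D $ Upair i i = 0" for i
  proof -
    have "?D $ p * monomial (axis i 1) p = (if p = Upair i i then ?D $ p else 0)" for p
      by (cases p) (auto simp: monomial_Upair axis_nth_if)
    then have "quad_eval (axis i 1) ?D = ?D $ Upair i i"
      by (simp add: quad_eval_def)
    then show ?thesis using z by simp
  qed
  have "?D $ Upair i j = 0" if "i \<noteq> j" for i j
  proof -
    have "?D $ p * monomial (axis i 1 + axis j 1) p = (if p = Upair i j then ?D $ p else 0)" for p
      using that diag by (cases p) (auto simp: monomial_Upair axis_nth_if)
    then have "quad_eval (axis i 1 + axis j 1) ?D = ?D $ Upair i j"
      by (simp add: quad_eval_def)
    then show ?thesis using z by simp
  qed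
  with diag have "?D $ p = 0" for p
    by (cases p) (metis)
  then show ?thesis by (simp add: vec_eq_iff)
qed

lemma quad_eval_tensor_map:
  "quad_eval v (tensor_row e (tensor_map (\<lambda>g f. tensor g (sym_prod f b)) T)) =
     scalar_product (tensor_row e T) v * scalar_product b v"
proof -
  have "quad_eval v (tensor_row e (tensor_map (\<lambda>g f. tensor g (sym_prod f b)) T)) =
      (\<Sum>i\<in>UNIV. \<Sum>j\<in>UNIV. T $ (i, j) * (axis i 1 $ e * (v $ j * scalar_product b v)))"
    by (simp add: tensor_map_def tensor_row_sum tensor_row_linear tensor_row_tensor quad_eval_sum quad_eval_linear
        quad_eval_sym_prod scalar_product_axis mult.assoc)
  also have "\<dots> = (\<Sum>i\<in>UNIV. if i = e then \<Sum>j\<in>UNIV. T $ (e, j) * (v $ j * scalar_product b v) else 0)"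
    by (intro sum.cong refl) (auto simp: axis_nth_if)
  also have "\<dots> = scalar_product (tensor_row e T) v * scalar_product b v"
  proof -
    have "scalar_product (tensor_row e T) v = (\<Sum>j\<in>UNIV. T $ (e, j) * v $ j)"
      by (simp add: scalar_product_def tensor_row_def)
    then show ?thesis by (simp add: sum_distrib_left mult_ac)
  qed
  finally show ?thesis .
qed

lemma ext2_tensor_map_linear: "ext2_tensor_map \<phi> (S + T) = ext2_tensor_map \<phi> S + ext2_tensor_map \<phi> T"
  "ext2_tensor_map \<phi> (c *s S) = c *s ext2_tensor_map \<phi> S" "ext2_tensor_map \<phi> 0 = 0"
  by (simp_all add: ext2_tensor_map_def vector_sadd_rdistrib sum.distrib vec_scale_sum vector_smult_assoc)

lemma ext2_tensor_map_sum: "ext2_tensor_map \<phi> (\<Sum>i\<in>A. f i) = (\<Sum>i\<in>A. ext2_tensor_map \<phi> (f i))"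
  by (induction A rule: infinite_finite_induct) (simp_all add: ext2_tensor_map_linear)

lemma tensor_linear:
  fixes a b :: "'a::comm_ring_1^'n" and c :: "'a^'m"
  shows "tensor (a + b) c = tensor a c + tensor b c" "tensor a (c + c') = tensor a c + tensor a c'"
  "tensor (r *s a) c = r *s tensor a c" "tensor a (r *s c) = r *s tensor a c"
  by (simp_all add: tensor_def vec_eq_iff algebra_simps)

lemma sym_prod_linear: "sym_prod (a + b) c = sym_prod a c + sym_prod b c" "sym_prod a (b + c) = sym_prod a b + sym_prod a c"
  "sym_prod (r *s a) c = r *s sym_prod a c" "sym_prod a (r *s c) = r *s sym_prod a c"
  by (simp_all add: sym_prod_def vec_eq_iff sum.distrib sum_distrib_left algebra_simps)

lemma quad_eval_ext2_tensor_map: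
  fixes d :: "'a::comm_ring_1^'r::{finite,linorder}^'q"
  shows "quad_eval v (tensor_row e (ext2_tensor_map
      (\<lambda>g g' f. tensor g (sym_prod (d *v g') f) - tensor g' (sym_prod (d *v g) f)) (tensor (wedge2 a b) f))) =
    (a $ e * scalar_product (d *v b) v - b $ e * scalar_product (d *v a) v) * scalar_product f v"
proof -
  have "ext2_tensor_map
      (\<lambda>g g' f. tensor g (sym_prod (d *v g') f) - tensor g' (sym_prod (d *v g) f)) (tensor (wedge2 a b) f) =
      tensor a (sym_prod (d *v b) f) - tensor b (sym_prod (d *v a) f)"
    by (rule ext2_tensor_map_wedge2)
      (auto intro!: linear_mapI simp: matrix_vector_mult_add matrix_vector_mult_scale tensor_linear
        sym_prod_linear vector_ssub_ldistrib)
  then show ?thesis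
    by (simp only: tensor_row_linear tensor_row_tensor quad_eval_linear quad_eval_sym_prod) (simp add: algebra_simps)
qed

section \<open>Exterior squares of a free module of rank two\<close>

lemma sum_UNIV_2: "(\<Sum>i\<in>(UNIV::2 set). f i) = f 1 + f 2"
  by (simp add: UNIV_2)

text \<open>In the linear order of the index type \<open>2\<close> the element \<open>2 = 0\<close> precedes \<open>1\<close>.  Hence the one
coordinate of \<open>\<And>\<^sup>2\<close> selected by this order is that of \<open>g\<^sub>2 \<and> g\<^sub>1\<close>, which is the source of the
minus signs in \<open>ext2_pairing_2\<close> and \<open>ext2_tensor_pairing_2\<close>.\<close>

lemma greaterThan_2: "{(2::2)<..} = {1}" "{(1::2)<..} = {}"
  and atLeast_2: "{(2::2)..} = {2, 1}" "{(1::2)..} = {1}"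
proof -
  have "Rep_bit0 (0::2) = 0" "Rep_bit0 (1::2) = 1"
    by (rule bit0.Rep_0, rule bit0.Rep_1)
  moreover have "(2::2) = 0"
    by simp
  ultimately have 01: "(2::2) < 1"
    by (metis less_bit0_def zero_less_one)
  have cases: "i = 1 \<or> i = 2" for i :: 2
    by (rule exhaust_2)
  show "{(2::2)<..} = {1}" "{(1::2)<..} = {}" "{(2::2)..} = {2, 1}" "{(1::2)..} = {1}"
    using 01 cases by (auto simp: order_less_imp_le) (metis order_less_asym order_less_irrefl order_le_less)+
qed

lemma std_2: "std 1 = (axis 1 1 :: 'a::comm_ring_1^2)" "std 2 = (axis 2 1 :: 'a::comm_ring_1^2)"
  by (simp_all add: std_def)

lemma ext2_map_2: "ext2_map \<phi> T = T $ (2, 1) *s \<phi> (axis 2 1) (axis (1::2) 1)"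
  by (simp add: ext2_map_def sum_UNIV_2 greaterThan_2)

lemma ext2_pairing_2: "ext2_pairing T (std 1) (std (2::nat)) = - T $ (2, 1::2)"
  by (simp add: ext2_pairing_def sum_UNIV_2 greaterThan_2 std_2 axis_def del: One_nat_def)

lemma ext2_tensor_map_2: "ext2_tensor_map \<phi> T =
   (\<Sum>k\<in>UNIV. T $ ((2, 1), k) *s \<phi> (axis 2 1) (axis (1::2) 1) (axis k 1))"
  by (simp add: ext2_tensor_map_def sum_UNIV_2 greaterThan_2)

lemma ext2_tensor_pairing_2: "ext2_tensor_pairing T (std 1) (std (2::nat)) (axis k 1) = - T $ ((2, 1::2), k)"
  by (simp add: ext2_tensor_pairing_def sum_UNIV_2 greaterThan_2 std_2 axis_def if_distrib
      del: One_nat_def cong: if_cong)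

lemma ext2_pairing_linear: "ext2_pairing (v + w) g g' = ext2_pairing v g g' + ext2_pairing w g g'"
  "ext2_pairing (c *s v) g g' = c * ext2_pairing v g g'" "ext2_pairing 0 g g' = 0"
  by (simp_all add: ext2_pairing_def distrib_right sum.distrib sum_distrib_left mult.assoc)

lemma ext2_tensor_pairing_linear:
  "ext2_tensor_pairing (v + w) g g' d =
    ext2_tensor_pairing v g g' d + ext2_tensor_pairing w g g' d"
  "ext2_tensor_pairing (c *s v) g g' d = c * ext2_tensor_pairing v g g' d"
  "ext2_tensor_pairing 0 g g' d = 0"
  by (simp_all add: ext2_tensor_pairing_def distrib_right sum.distrib sum_distrib_left mult.assoc)

section \<open>Identities between the structure maps of a resolution\<close>

locale structure_maps =
  fixes a1 :: "'a::comm_ring_1^5" and a2 :: "'a^'q^5" and a3 :: "'a^2^'q"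
    and w31 :: "('a^5) list \<Rightarrow> 'a^'q"
    and w21 :: "'a^5 \<Rightarrow> 'a^'q \<Rightarrow> 'a^2"
    and w11 :: "('a^5) list \<Rightarrow> 'a^2"
    and w32 :: "('a^5) list \<Rightarrow> 'a^(2 \<times> 'q)"
    and w22 :: "('a^5) list \<Rightarrow> 'a^'q \<Rightarrow> 'a^(2 \<times> 2)"
    and w122 :: "('a^5) list \<Rightarrow> 'a^(2 uprod)"
    and w23 :: "('a^5) list \<Rightarrow> 'a^'q \<Rightarrow> 'a^((2 \<times> 2) \<times> 2)"
  assumes two_half_one: "2 * half = (1 :: 'a)"
    and a1_a2: "\<And>f. scalar_product a1 (a2 *v f) = 0"
    and inj_a3: "inj ((*v) a3)"
    and w31: "is_w31 (a1, a2, a3) w31"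
    and w21: "is_w21 (a1, a2, a3) w31 w21"
    and w11: "is_w11 (a1, a2, a3) w31 w11"
    and w32: "is_w32 (a1, a2, a3) w31 w32"
    and w22: "is_w22 (a1, a2, a3) w31 w21 w11 w32 w22"
    and w122: "is_w122 (a1, a2, a3) w31 w11 [std 1, std 2, std 3, std 4, std 5] w122"
    and w23: "is_w23 (a1, a2, a3) w21 w32 w122 [std 1, std 2, std 3, std 4, std 5] w23"
begin

lemma half_double: "half * (2 * a) = (a :: 'a)"
  using two_half_one by (metis mult.assoc mult.commute mult_1)

lemma a3_cancel: "a3 *v g = a3 *v g' \<Longrightarrow> g = g'"
  using inj_a3 by (auto dest: injD)

lemma alt_w31: "alternating_map 2 w31" and alt_w11: "alternating_map 3 w11"
  and alt_w32: "alternating_map 4 w32" and alt_w22: "alternating_map 3 (\<lambda>xs. w22 xs f)"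
  and alt_w122: "alternating_map 5 w122" and alt_w23: "alternating_map 5 (\<lambda>xs. w23 xs f)"
  using w31 w11 w32 w22 w122 w23
  by (simp_all add: is_w31_def is_w11_def is_w32_def is_w22_def is_w122_def is_w23_def)

lemma a3_w21: "a3 *v w21 x f = scalar_product a1 x *s f - w31 [x, a2 *v f]"
  and a3_w11: "a3 *v w11 [x, y, z] =
        scalar_product a1 x *s w31 [y, z] - scalar_product a1 y *s w31 [x, z]
        + scalar_product a1 z *s w31 [x, y]"
  using w21 w11 by (simp_all add: is_w21_def is_w11_def)

lemma w21_self: "w21 (a2 *v f) f = 0"
  by (rule a3_cancel) (simp add: a3_w21 a1_a2 alternating_map_2D(3)[OF alt_w31])

lemma w31_skew: "w31 [y, x] = - w31 [x, y]"
  using alternating_map_swap[OF alt_w31, of "[x, y]" 0 1] by simp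

text \<open>Both sides have the same image under \<open>a\<^sub>3\<close>, as \<open>a\<^sub>1\<close> kills \<open>a\<^sub>2 f\<close>.\<close>

lemma w11_boundary: "w11 [x, y, a2 *v f] =
    scalar_product a1 y *s w21 x f - scalar_product a1 x *s w21 y f"
  by (rule a3_cancel)
    (simp add: a3_w11 a3_w21 a1_a2
      matrix_vector_mult_diff_distrib matrix_vector_mult_scale vec_eq_iff algebra_simps)

text \<open>The map \<open>x \<and> y \<and> z \<mapsto> x \<cdot> y \<cdot> z\<close> is annihilated by the Koszul differential of \<open>a\<^sub>1\<close>, since \<open>a\<^sub>3\<close>
turns it into a Koszul boundary.\<close>

lemma w11_cycle: "scalar_product a1 x0 *s w11 [x1, x2, x3] - scalar_product a1 x1 *s w11 [x0, x2, x3]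
   + scalar_product a1 x2 *s w11 [x0, x1, x3] - scalar_product a1 x3 *s w11 [x0, x1, x2] = 0"
  by (rule a3_cancel)
    (simp add: a3_w11 matrix_vector_mult_add matrix_vector_mult_diff_distrib
      matrix_vector_mult_scale vec_eq_iff algebra_simps)

text \<open>The map \<open>\<And>\<^sup>2 F\<^sub>3 \<rightarrow> F\<^sub>2 \<otimes> F\<^sub>3\<close> sends \<open>g\<^sub>1 \<and> g\<^sub>2\<close> to \<open>d\<^sub>3(g\<^sub>1) \<otimes> g\<^sub>2 - d\<^sub>3(g\<^sub>2) \<otimes> g\<^sub>1\<close>; this is the
coefficient of \<open>g\<^sub>v\<close> in it.  The same vector is the coefficient of \<open>g\<^sub>v\<^sup>2\<close> in the image of
\<open>(g\<^sub>1 \<and> g\<^sub>2) \<otimes> g\<^sub>v\<close> under \<open>\<And>\<^sup>2 F\<^sub>3 \<otimes> F\<^sub>3 \<rightarrow> S\<^sub>2 F\<^sub>3 \<otimes> F\<^sub>2\<close>, so that one scalar multiple of it determines a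
coordinate of \<open>w\<^sup>(\<^sup>2\<^sup>)\<^sub>2\<close> as well as one of \<open>w\<^sup>(\<^sup>2\<^sup>)\<^sub>3\<close>.\<close>

definition wedge_d3 :: "2 \<Rightarrow> 'a^'q" where
  "wedge_d3 v = (if v = 1 then - (a3 *v axis 2 1) else a3 *v axis 1 1)"

lemma wedge_d3_cancel:
  assumes "c *s wedge_d3 v = c' *s wedge_d3 v" shows "c = c'"
proof (cases "v = 1")
  case True
  then have "a3 *v (c *s axis 2 1) = a3 *v (c' *s axis 2 1)"
    using assms by (simp add: wedge_d3_def matrix_vector_mult_scale vec_eq_iff
        del: matrix_vector_mul_component)
  then have "c *s axis (2::2) (1::'a) = c' *s axis 2 1" by (rule a3_cancel)
  from arg_cong[OF this, of "\<lambda>v. v $ 2"] show ?thesis by (simp add: axis_nth_if)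
next
  case False
  then have "a3 *v (c *s axis 1 1) = a3 *v (c' *s axis 1 1)"
    using assms by (simp add: wedge_d3_def matrix_vector_mult_scale)
  then have "c *s axis (1::2) (1::'a) = c' *s axis 1 1" by (rule a3_cancel)
  from arg_cong[OF this, of "\<lambda>v. v $ 1"] show ?thesis by (simp add: axis_nth_if)
qed

text \<open>As \<open>\<And>\<^sup>2 F\<^sub>3\<close> has rank one, \<open>w\<^sup>(\<^sup>2\<^sup>)\<^sub>2\<close> is the scalar \<open>pair22\<close> times \<open>g\<^sub>1 \<and> g\<^sub>2\<close>, and \<open>w\<^sup>(\<^sup>2\<^sup>)\<^sub>3\<close> is the sum
over \<open>v\<close> of \<open>pair23 v\<close> times \<open>(g\<^sub>1 \<and> g\<^sub>2) \<otimes> g\<^sub>v\<close>.\<close>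

definition pair22 :: "('a^5) list \<Rightarrow> 'a^'q \<Rightarrow> 'a" where
  "pair22 xs f = ext2_pairing (w22 xs f) (std 1) (std 2)"

definition pair23 :: "2 \<Rightarrow> ('a^5) list \<Rightarrow> 'a^'q \<Rightarrow> 'a" where
  "pair23 v xs f = ext2_tensor_pairing (w23 xs f) (std 1) (std 2) (axis v 1)"

text \<open>The coefficient of \<open>g\<^sub>v\<close> in the defining equation of \<open>w\<^sup>(\<^sup>2\<^sup>)\<^sub>2\<close>.\<close>

lemma pair22_wedge_d3: "pair22 [x, y, z] f *s wedge_d3 v =
    w21 z f $ v *s w31 [x, y] - w21 y f $ v *s w31 [x, z] + w21 x f $ v *s w31 [y, z]
    + tensor_row v (w32 [x, y, z, a2 *v f]) - w11 [x, y, z] $ v *s f"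
proof -
  have *: "ext2_map (\<lambda>g g'. tensor (a3 *v g) g' - tensor (a3 *v g') g) (w22 [x, y, z] f) =
        tensor (w31 [x, y]) (w21 z f) - tensor (w31 [x, z]) (w21 y f)
        + tensor (w31 [y, z]) (w21 x f) + tensor_swap (w32 [x, y, z, a2 *v f])
        - tensor f (w11 [x, y, z])"
    using w22 by (simp add: is_w22_def)
  have "(pair22 [x, y, z] f *s wedge_d3 v) $ h =
    (w21 z f $ v *s w31 [x, y] - w21 y f $ v *s w31 [x, z] + w21 x f $ v *s w31 [y, z]
    + tensor_row v (w32 [x, y, z, a2 *v f]) - w11 [x, y, z] $ v *s f) $ h" for h
  proof -
    have v: "v = 1 \<or> v = 2" by (rule exhaust_2)
    show ?thesis
      using arg_cong[OF *, of "\<lambda>T. T $ (h, v)"] v unfolding pair22_def ext2_pairing_2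
      by (auto simp: ext2_map_2 wedge_d3_def tensor_def tensor_swap_def tensor_row_def
          mult_axis_nth axis_def algebra_simps)
  qed
  then show ?thesis by (simp only: vec_eq_iff) simp
qed

text \<open>The identity \<open>w\<^sup>(\<^sup>2\<^sup>)\<^sub>2(x \<and> y \<and> a\<^sub>2 f \<otimes> f) = (x \<cdot> f) \<and> (y \<cdot> f)\<close>.  One coefficient suffices for its
proof because a multiple of \<open>d\<^sub>3(g\<^sub>1)\<close> determines the scalar; with \<open>v = 2\<close> the right-hand side becomes
\<open>d\<^sub>3\<close> of the combination of \<open>x \<cdot> f\<close> and \<open>y \<cdot> f\<close> in which \<open>g\<^sub>2\<close> cancels.\<close>

lemma pair22_boundary:
  "pair22 [x, y, a2 *v f] f = w21 x f $ 1 * w21 y f $ 2 - w21 x f $ 2 * w21 y f $ 1"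
proof -
  let ?p = "\<lambda>v x. w21 x f $ v"
  let ?D = "?p 1 x * ?p 2 y - ?p 2 x * ?p 1 y"
  have "w32 [x, y, a2 *v f, a2 *v f] = 0"
    by (rule alternating_map_4D(7)[OF alt_w32])
  then have "pair22 [x, y, a2 *v f] f *s wedge_d3 2 = a3 *v (?p 2 y *s w21 x f - ?p 2 x *s w21 y f)"
    unfolding pair22_wedge_d3
    by (simp add: a3_w21 w21_self w11_boundary matrix_vector_mult_scale
        matrix_vector_mult_diff_distrib tensor_row_def vec_eq_iff algebra_simps)
  also have "?p 2 y *s w21 x f - ?p 2 x *s w21 y f = ?D *s axis 1 1"
    by (auto simp: vec_eq_iff forall_2 axis_def algebra_simps)
  also have "a3 *v (?D *s axis 1 1) = ?D *s wedge_d3 2"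
    by (simp only: matrix_vector_mult_scale) (simp add: wedge_d3_def)
  finally show ?thesis by (rule wedge_d3_cancel)
qed

text \<open>Half the partial derivative of the quadratic form \<open>T\<close> in \<open>g\<^sub>1, g\<^sub>2\<close> with respect to \<open>g\<^sub>v\<close>.  The index
\<open>v + 1\<close>, modulo 2, is the one different from \<open>v\<close>.  The map \<open>S\<^sub>2 F\<^sub>3 \<rightarrow> F\<^sub>2 \<otimes> F\<^sub>3\<close> takes \<open>T\<close> to the sum of
\<open>d\<^sub>3(half_deriv v T) \<otimes> g\<^sub>v\<close>.\<close>

definition half_deriv :: "2 \<Rightarrow> 'a^(2 uprod) \<Rightarrow> 'a^2" where
  "half_deriv v T = T $ Upair v v *s axis v 1 + (half * T $ Upair 1 2) *s axis (v + 1) 1"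

lemma half_deriv_nth: "half_deriv v T $ v = T $ Upair v v"
  by (simp add: half_deriv_def axis_def)

lemma linear_half_deriv: "linear_map (half_deriv v)"
  by (rule linear_mapI) (simp_all add: half_deriv_def vec_eq_iff algebra_simps)

text \<open>The coefficient of \<open>g\<^sub>v\<close> in the defining equation of \<open>w\<^sup>(\<^sup>1\<^sup>)\<^sub>2\<^sub>,\<^sub>2\<close>, extended from the standard basis to
all tuples.\<close>

lemma a3_half_deriv:
  assumes "length ys = 5"
  shows "a3 *v half_deriv v (w122 ys) = shuffle23 w31 (\<lambda>zs. w11 zs $ v) ys"
proof (rule alternating_map_eq_of_std[OF _ _ assms])
  show "alternating_map 5 (\<lambda>ys. a3 *v half_deriv v (w122 ys))"
    by (intro alternating_map_comp[OF matrix_vector_mult_linear] alternating_map_comp[OF linear_half_deriv] alt_w122)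
  show "alternating_map 5 (shuffle23 w31 (\<lambda>zs. w11 zs $ v))"
    by (rule shuffle23_alternating[OF alt_w31 alt_w11])
  let ?ys = "[std 1, std 2, std 3, std 4, std 5] :: ('a^5) list"
  have *: "sym2_map (\<lambda>g g'. half *s (tensor (a3 *v g) g' + tensor (a3 *v g') g)) (w122 ?ys) =
       (\<Sum>i\<in>{1..5}. \<Sum>j\<in>{i<..5}. (-1) ^ (i + j + 1) *s
          tensor (w31 [nth1 ?ys i, nth1 ?ys j]) (w11 (omit i (omit j ?ys))))"
    using w122 by (simp add: is_w122_def del: One_nat_def)
  have R: "(\<Sum>i\<in>{1..5}. \<Sum>j\<in>{i<..5}. (-1) ^ (i + j + 1) *s
          tensor (w31 [nth1 ?ys i, nth1 ?ys j]) (w11 (omit i (omit j ?ys)))) $ (h, v) =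
       shuffle23 w31 (\<lambda>zs. w11 zs $ v) ?ys $ h" for h
    unfolding shuffle23_def by (simp add: tensor_def mult_ac)
  have three: "(3 :: 2) = 1"
    by simp
  have L: "sym2_map (\<lambda>g g'. half *s (tensor (a3 *v g) g' + tensor (a3 *v g') g)) T $ (h, v) =
      (a3 *v half_deriv v T) $ h" for h and T :: "'a^(2 uprod)"
  proof -
    have v: "v = 1 \<or> v = 2" by (rule exhaust_2)
    have U: "Upair 2 (1::2) = Upair 1 2" by simp
    show ?thesis
      using v by (auto simp: sym2_map_def sum_UNIV_2 atLeast_2 half_deriv_def
          matrix_vector_mult_add matrix_vector_mult_scale tensor_def
          axis_nth_if half_double U algebra_simps, simp_all add: three algebra_simps)
  qed
  show "a3 *v half_deriv v (w122 ?ys) = shuffle23 w31 (\<lambda>zs. w11 zs $ v) ?ys"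
    unfolding vec_eq_iff L[symmetric] R[symmetric] * by simp
qed

lemma linear_tensor_row: "linear_map (tensor_row v)"
  by (rule linear_mapI) (simp_all add: tensor_row_def vec_eq_iff)

text \<open>The coefficient of \<open>g\<^sub>v\<^sup>2\<close> in the defining equation of \<open>w\<^sup>(\<^sup>2\<^sup>)\<^sub>3\<close>, extended from the standard basis to
all tuples.  The coefficient of the mixed product \<open>g\<^sub>1 g\<^sub>2\<close> would involve both coordinates of
\<open>w\<^sup>(\<^sup>2\<^sup>)\<^sub>3\<close>; the squares isolate one each.\<close>

lemma pair23_wedge_d3:
  assumes "length ys = 5"
  shows "pair23 v ys f *s wedge_d3 v =
     shuffle14 (\<lambda>y. w21 y f $ v) (\<lambda>zs. tensor_row v (w32 zs)) ys - (half * w122 ys $ Upair v v) *s f"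
proof (rule alternating_map_eq_of_std[OF _ _ assms])
  have "linear_map (\<lambda>T. ext2_tensor_pairing T (std 1) (std (2::nat)) (axis v 1) *s wedge_d3 v)"
    by (intro linear_mapI) (simp_all add: ext2_tensor_pairing_linear vector_sadd_rdistrib del: One_nat_def)
  then show "alternating_map 5 (\<lambda>ys. pair23 v ys f *s wedge_d3 v)"
    unfolding pair23_def by (rule alternating_map_comp[OF _ alt_w23])
  have "linear_map (\<lambda>T. (half * T $ Upair v v) *s f)"
    by (intro linear_mapI) (simp_all add: vec_eq_iff algebra_simps)
  moreover have "linear_map (\<lambda>y. w21 y f)"
    using w21 by (simp add: is_w21_def)
  ultimately show "alternating_map 5 (\<lambda>ys. shuffle14 (\<lambda>y. w21 y f $ v) (\<lambda>zs. tensor_row v (w32 zs)) ys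
      - (half * w122 ys $ Upair v v) *s f)"
    by (intro alternating_map_diff shuffle14_alternating alternating_map_comp[OF linear_tensor_row]
        alternating_map_comp[of "\<lambda>T. (half * T $ Upair v v) *s f"] alt_w32 alt_w122)
  let ?ys = "[std 1, std 2, std 3, std 4, std 5] :: ('a^5) list"
  have *: "ext2_tensor_map (\<lambda>a b c. tensor (sym_prod c b) (a3 *v a) - tensor (sym_prod c a) (a3 *v b))
            (w23 ?ys f) =
        (\<Sum>i\<in>{1..5}. (-1) ^ (i + 1) *s
           tensor_map (\<lambda>g' f'. tensor (sym_prod (w21 (nth1 ?ys i) f) g') f') (w32 (omit i ?ys)))
        - half *s tensor (w122 ?ys) f"
    using w23 by (simp add: is_w23_def del: One_nat_def)
  have L: "ext2_tensor_map (\<lambda>a b c. tensor (sym_prod c b) (a3 *v a) - tensor (sym_prod c a) (a3 *v b)) T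
      $ (Upair v v, h) = (ext2_tensor_pairing T (std 1) (std 2) (axis v 1) *s wedge_d3 v) $ h" for T h
  proof -
    have v: "v = 1 \<or> v = 2" by (rule exhaust_2)
    then show ?thesis unfolding ext2_tensor_pairing_2
      by (auto simp: ext2_tensor_map_2 sum_UNIV_2 wedge_d3_def tensor_def sym_prod_nth
          axis_nth_if)
  qed
  have R: "tensor_map (\<lambda>g' f'. tensor (sym_prod c g') f') T $ (Upair v v, h) = c $ v * tensor_row v T $ h"
    for c :: "'a^2" and T :: "'a^(2 \<times> 'q)" and h
  proof -
    have "T $ (i, j) * (c $ v * axis i 1 $ v * axis j 1 $ h) =
        (if j = h then if i = v then c $ v * T $ (v, h) else 0 else 0)" for i j
      by (simp add: axis_nth_if)
    then show ?thesis
      by (simp add: tensor_map_def tensor_def sym_prod_nth tensor_row_def)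
  qed
  have "(pair23 v ?ys f *s wedge_d3 v) $ h = (shuffle14 (\<lambda>y. w21 y f $ v) (\<lambda>zs. tensor_row v (w32 zs)) ?ys
      - (half * w122 ?ys $ Upair v v) *s f) $ h" for h
    unfolding pair23_def L[symmetric] * shuffle14_def
    by (simp add: R tensor_def mult_ac del: One_nat_def)
  then show "pair23 v ?ys f *s wedge_d3 v = shuffle14 (\<lambda>y. w21 y f $ v) (\<lambda>zs. tensor_row v (w32 zs)) ?ys
      - (half * w122 ?ys $ Upair v v) *s f"
    by (simp only: vec_eq_iff) simp
qed

text \<open>Substituting \<open>a\<^sub>2 f\<close> in the shuffle product of \<open>x \<cdot> y\<close> and \<open>x \<cdot> y \<cdot> z\<close> turns it into \<open>d\<^sub>3\<close> of the
polarization of \<open>\<Sum> \<plusminus> (x\<^sub>i \<cdot> f) (x\<^sub>j \<cdot> x\<^sub>k \<cdot> x\<^sub>l)\<close>, up to a multiple of \<open>f\<close> that vanishes by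
\<open>w11_cycle\<close>.\<close>

lemma w122_boundary:
  "half * w122 [a2 *v f, x0, x1, x2, x3] $ Upair v v =
     w21 x0 f $ v * w11 [x1, x2, x3] $ v - w21 x1 f $ v * w11 [x0, x2, x3] $ v
     + w21 x2 f $ v * w11 [x0, x1, x3] $ v - w21 x3 f $ v * w11 [x0, x1, x2] $ v"
proof -
  let ?z = "a2 *v f"
  let ?s = "\<lambda>x t. w21 x f $ v *s t + t $ v *s w21 x f"
  have rot: "w11 [?z, x, y] = w11 [x, y, ?z]" for x y
    using alternating_map_swap[OF alt_w11, of "[?z, x, y]" 0 1]
      alternating_map_swap[OF alt_w11, of "[x, ?z, y]" 1 2] by simp
  let ?c = "scalar_product a1 x0 *s w11 [x1, x2, x3] - scalar_product a1 x1 *s w11 [x0, x2, x3]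
   + scalar_product a1 x2 *s w11 [x0, x1, x3] - scalar_product a1 x3 *s w11 [x0, x1, x2]"
  \<comment> \<open>Each summand of \<open>?r\<close> is the partial derivative by \<open>g\<^sub>v\<close> of a product in \<open>S\<^sub>2 F\<^sub>3\<close>.\<close>
  let ?r = "?s x0 (w11 [x1, x2, x3]) - ?s x1 (w11 [x0, x2, x3])
    + ?s x2 (w11 [x0, x1, x3]) - ?s x3 (w11 [x0, x1, x2])"
  have "(a3 *v half_deriv v (w122 [?z, x0, x1, x2, x3])) $ h = (a3 *v ?r - ?c $ v *s f) $ h" for h
    unfolding a3_half_deriv[of "[_, _, _, _, _]", simplified] shuffle23_expand rot w11_boundary
      a3_w11 a3_w21 matrix_vector_mult_add matrix_vector_mult_scale matrix_vector_mult_diff_distrib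
      w31_skew[of ?z] vec_eq_iff vector_add_component vector_minus_component
      vector_smult_component vector_uminus_component
    by (simp add: algebra_simps)
  then have "a3 *v half_deriv v (w122 [?z, x0, x1, x2, x3]) = a3 *v ?r - ?c $ v *s f"
    by (simp only: vec_eq_iff) simp
  also have "\<dots> = a3 *v ?r"
    by (simp only: w11_cycle) simp
  finally have "half_deriv v (w122 [?z, x0, x1, x2, x3]) = ?r"
    by (rule a3_cancel)
  from arg_cong[OF this, of "\<lambda>t. t $ v"]
  have "w122 [?z, x0, x1, x2, x3] $ Upair v v =
     2 * (w21 x0 f $ v * w11 [x1, x2, x3] $ v - w21 x1 f $ v * w11 [x0, x2, x3] $ v
     + w21 x2 f $ v * w11 [x0, x1, x3] $ v - w21 x3 f $ v * w11 [x0, x1, x2] $ v)"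
    by (simp add: half_deriv_nth algebra_simps)
  then show ?thesis
    by (simp only: half_double)
qed

text \<open>Multiplied by \<open>wedge_d3 v\<close>, each \<open>w\<^sup>(\<^sup>2\<^sup>)\<^sub>2\<close> on the right expands by its defining equation.  The products
\<open>(x\<^sub>i \<cdot> f) (x\<^sub>l \<cdot> f)\<close> appear twice with opposite signs, the values of \<open>w\<^sup>(\<^sup>3\<^sup>)\<^sub>2\<close> are those in the equation for
\<open>w\<^sup>(\<^sup>2\<^sup>)\<^sub>3\<close>, where the summand with \<open>a\<^sub>2 f \<cdot> f = 0\<close> is missing, and the remaining multiple of \<open>f\<close> is
\<open>w122_boundary\<close>.\<close>

lemma pair23_boundary:
  "pair23 v [a2 *v f, x0, x1, x2, x3] f =
     w21 x0 f $ v * pair22 [x1, x2, x3] f - w21 x1 f $ v * pair22 [x0, x2, x3] f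
     + w21 x2 f $ v * pair22 [x0, x1, x3] f - w21 x3 f $ v * pair22 [x0, x1, x2] f"
    (is "_ = ?r")
proof -
  let ?z = "a2 *v f"
  have rot: "w32 [x, y, t, ?z] = - w32 [?z, x, y, t]" for x y t
    using alternating_map_swap[OF alt_w32, of "[?z, x, y, t]" 0 1]
      alternating_map_swap[OF alt_w32, of "[x, ?z, y, t]" 1 2]
      alternating_map_swap[OF alt_w32, of "[x, y, ?z, t]" 2 3] by simp
  have neg: "tensor_row v (- T) = - tensor_row v T" for T :: "'a^(2 \<times> 'q)"
    by (simp add: tensor_row_def vec_eq_iff)
  have "?r *s wedge_d3 v =
     w21 x0 f $ v *s (pair22 [x1, x2, x3] f *s wedge_d3 v) - w21 x1 f $ v *s (pair22 [x0, x2, x3] f *s wedge_d3 v)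
     + w21 x2 f $ v *s (pair22 [x0, x1, x3] f *s wedge_d3 v) - w21 x3 f $ v *s (pair22 [x0, x1, x2] f *s wedge_d3 v)"
    by (simp add: vec_eq_iff algebra_simps)
  also have "\<dots> = shuffle14 (\<lambda>y. w21 y f $ v) (\<lambda>zs. tensor_row v (w32 zs)) [?z, x0, x1, x2, x3]
      - (half * w122 [?z, x0, x1, x2, x3] $ Upair v v) *s f" (is "?A = ?B")
  proof -
    have "?A $ h = ?B $ h" for h
      unfolding pair22_wedge_d3 w122_boundary shuffle14_expand w21_self rot neg vector_add_component
        vector_minus_component vector_smult_component vector_uminus_component zero_index
      by (simp add: algebra_simps)
    then show ?thesis by (simp only: vec_eq_iff) simp
  qed
  also have "\<dots> = pair23 v [?z, x0, x1, x2, x3] f *s wedge_d3 v"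
    by (simp add: pair23_wedge_d3)
  finally show ?thesis
    by (rule wedge_d3_cancel[symmetric])
qed

end

section \<open>The mapping cone\<close>

lemma basis_cone:
  "[std_l 1, std_l 2, std_r 1, std_r 2, std_r 3 :: 'a::comm_ring_1^(2 + 3)] =
     map (\<lambda>i. axis i 1) [Inl 1, Inl 2, Inr 1, Inr 2, Inr 3]"
  "distinct [Inl 1, Inl 2, Inr 1, Inr 2, Inr 3 :: 2 + 3]"
  "set [Inl 1, Inl 2, Inr 1, Inr 2, Inr 3 :: 2 + 3] = UNIV"
proof -
  show d: "distinct [Inl 1, Inl 2, Inr 1, Inr 2, Inr 3 :: 2 + 3]" by simp
  have "card (set [Inl 1, Inl 2, Inr 1, Inr 2, Inr 3 :: 2 + 3]) = CARD(2 + 3)"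
    by (subst distinct_card[OF d]) simp
  then show "set [Inl 1, Inl 2, Inr 1, Inr 2, Inr 3 :: 2 + 3] = UNIV"
    by (intro card_subset_eq) auto
  show "[std_l 1, std_l 2, std_r 1, std_r 2, std_r 3 :: 'a::comm_ring_1^(2 + 3)] =
     map (\<lambda>i. axis i 1) [Inl 1, Inl 2, Inr 1, Inr 2, Inr 3]"
    by (simp add: std_l_def std_r_def)
qed

lemma sum_Plus_UNIV:
  "(\<Sum>i\<in>(UNIV :: ('n::finite + 'k::finite) set). f i) =
    (\<Sum>i\<in>UNIV. f (Inl i)) + (\<Sum>i\<in>UNIV. f (Inr i))"
  unfolding UNIV_sum by (subst sum.union_disjoint) (auto simp: sum.reindex)

text \<open>An element \<open>v\<close> of the coordinate module of \<open>D\<^sub>2\<close>, used as an evaluation point, is a pair \<open>(f, \<tau>)\<close> with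
\<open>f\<close> in \<open>A\<^sub>2\<close> and \<open>\<tau>\<close> in the dual of \<open>B\<^sub>2\<close>; these are its two components.\<close>

definition left_part :: "'a^('n::finite + 'k::finite) \<Rightarrow> 'a^'n" where
  "left_part v = (\<chi> h. v $ Inl h)"
definition right_part :: "'a^('n::finite + 'k::finite) \<Rightarrow> 'a^'k" where
  "right_part v = (\<chi> h. v $ Inr h)"

lemma scalar_product_std_l: "scalar_product (std_l h) v = left_part v $ of_nat h"
  by (simp add: std_l_def scalar_product_axis left_part_def)
lemma scalar_product_std_r: "scalar_product (std_r h) v = right_part v $ of_nat h"
  by (simp add: std_r_def scalar_product_axis right_part_def)

text \<open>The transpose of the last differential of the cone is \<open>(f, \<tau>) \<mapsto> a\<^sub>2 f + \<alpha>\<^sub>1 \<tau>\<close>.\<close>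

lemma scalar_product_mapping_cone_d3:
  "scalar_product (snd (snd (mapping_cone (a1, a2, a3) x u w31 w11)) *v b) v =
     scalar_product b (a2 *v left_part v + u *v right_part v)"
proof -
  have "scalar_product (snd (snd (mapping_cone (a1, a2, a3) x u w31 w11)) *v b) v =
    (\<Sum>h\<in>UNIV. \<Sum>k\<in>UNIV. b $ k * (a2 $ k $ h * v $ Inl h)) +
    (\<Sum>h\<in>UNIV. \<Sum>k\<in>UNIV. b $ k * (u $ k $ h * v $ Inr h))"
    by (simp add: mapping_cone_def scalar_product_def matrix_vector_mult_def sum_Plus_UNIV transpose_def
        cone_beta1_def sum_distrib_left mult_ac)
  also have "\<dots> = (\<Sum>k\<in>UNIV. \<Sum>h\<in>UNIV. b $ k * (a2 $ k $ h * v $ Inl h)) +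
    (\<Sum>k\<in>UNIV. \<Sum>h\<in>UNIV. b $ k * (u $ k $ h * v $ Inr h))"
    by (intro arg_cong2[where f = "(+)"] sum.swap)
  also have "\<dots> = scalar_product b (a2 *v left_part v + u *v right_part v)"
    by (simp add: scalar_product_def matrix_vector_mult_def left_part_def right_part_def distrib_left sum.distrib
        sum_distrib_left)
  finally show ?thesis .
qed

text \<open>Evaluation at \<open>(e, v)\<close> turns the summand \<open>\<epsilon>\<^sub>i \<and> \<epsilon>\<^sub>k \<otimes> \<phi>\<^sub>h\<close> into the determinant of \<open>e\<close> and \<open>z\<close> in the
coordinates \<open>i\<close>, \<open>k\<close> times the coordinate \<open>h\<close> of \<open>f\<close>, so that the sum is the multilinear expansion of
\<open>C\<close>.\<close>

lemma eval_cone_lift: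
  fixes d :: "'a::comm_ring_1^5^(6 + 3)" and C :: "'a^5 \<Rightarrow> 'a^5 \<Rightarrow> 'a^6 \<Rightarrow> 'a"
  assumes C: "\<And>y f. linear_form (\<lambda>x. C x y f)" "\<And>x f. linear_form (\<lambda>y. C x y f)"
      "\<And>x y. linear_form (C x y)" "\<And>x f. C x x f = 0"
    and T: "T = (\<Sum>i\<in>{1..5}. \<Sum>k\<in>{i<..5}. \<Sum>h\<in>{1..6}.
        C (std i) (std k) (std h) *s tensor (wedge2 (std i) (std k)) (std_l h))"
    and d: "\<And>b. scalar_product (d *v b) v = scalar_product b z"
  shows "quad_eval v (tensor_row e (ext2_tensor_map
      (\<lambda>g g' f. tensor g (sym_prod (d *v g') f) - tensor g' (sym_prod (d *v g) f)) T)) =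
      C (axis e 1) z (left_part v)"
proof -
  have a: "std i $ e = (axis e 1 :: 'a^5) $ of_nat i" for i
    by (auto simp: std_def axis_nth_if)
  have b: "scalar_product (std i :: 'a^5) z = z $ of_nat i" for i
    by (simp add: std_def scalar_product_axis)
  have "quad_eval v (tensor_row e (ext2_tensor_map
      (\<lambda>g g' f. tensor g (sym_prod (d *v g') f) - tensor g' (sym_prod (d *v g) f)) T)) =
      (\<Sum>i\<in>{1..5}. \<Sum>k\<in>{i<..5}. \<Sum>h\<in>{1..6}. C (std i) (std k) (std h) *
       (((axis e 1) $ of_nat i * z $ of_nat k - (axis e 1) $ of_nat k * z $ of_nat i) * left_part v $ of_nat h))"
    unfolding T ext2_tensor_map_sum tensor_row_sum quad_eval_sum ext2_tensor_map_linear
      tensor_row_linear quad_eval_linear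
      quad_eval_ext2_tensor_map d scalar_product_std_l a b ..
  also have "\<dots> = (\<Sum>i\<in>{1..5}. \<Sum>k\<in>{i<..5}. (\<Sum>h\<in>{1..6}. C (std i) (std k) (std h) * left_part v $ of_nat h) *
       ((axis e 1) $ of_nat i * z $ of_nat k - (axis e 1) $ of_nat k * z $ of_nat i))"
    unfolding sum_distrib_right by (intro sum.cong refl) (simp add: mult_ac)
  also have "\<dots> = (\<Sum>i\<in>{1..5}. \<Sum>k\<in>{i<..5}. C (std i) (std k) (left_part v) *
       ((axis e 1) $ of_nat i * z $ of_nat k - (axis e 1) $ of_nat k * z $ of_nat i))"
    by (simp only: linear_form_std_6[OF C(3)])
  also have "\<dots> = C (axis e 1) z (left_part v)"
    by (rule alternating_form_std_5) (use C in auto)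
  finally show ?thesis .
qed

lemma eval_cone_w32:
  fixes C :: "'a::comm_ring_1^5 \<Rightarrow> 'a^6 \<Rightarrow> 'a"
  assumes C: "\<And>f. linear_form (\<lambda>x. C x f)" "\<And>x. linear_form (C x)"
  shows "scalar_product (tensor_row e (\<Sum>i\<in>{1..5}. \<Sum>h\<in>{1..6}.
      C (std i) (std h) *s tensor (std i) (std_l h))) v =
    C (axis e 1) (left_part v)"
proof -
  have a: "std i $ e = (axis e 1 :: 'a^5) $ of_nat i" for i
    by (auto simp: std_def axis_nth_if)
  have "scalar_product (tensor_row e (\<Sum>i\<in>{1..5}. \<Sum>h\<in>{1..6}.
      C (std i) (std h) *s tensor (std i) (std_l h))) v =
     (\<Sum>i\<in>{1..5}. (\<Sum>h\<in>{1..6}. C (std i) (std h) * left_part v $ of_nat h) * axis e 1 $ of_nat i)"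
    unfolding tensor_row_sum scalar_product_sum tensor_row_linear tensor_row_tensor
      scalar_product_linear scalar_product_std_l a sum_distrib_right
    by (intro sum.cong refl) (simp add: mult_ac)
  also have "\<dots> = C (axis e 1) (left_part v)"
    by (simp only: linear_form_std_6[OF C(2)] linear_form_std_5[OF C(1)])
  finally show ?thesis .
qed

lemma eval_cone_w31:
  fixes C :: "'a::comm_ring_1^6 \<Rightarrow> 'a"
  assumes "linear_form C"
  shows "scalar_product (\<Sum>h\<in>{1..6}. C (std h) *s std_l h) v = C (left_part v)"
  unfolding scalar_product_sum scalar_product_linear scalar_product_std_l by (rule linear_form_std_6[OF assms])

lemma ext2_tensorI:
  "(\<And>i k. T $ ((i, i), k) = 0) \<Longrightarrow> (\<And>i j k. T $ ((j, i), k) = - (T $ ((i, j), k))) \<Longrightarrow> T \<in> ext2_tensor"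
  unfolding ext2_tensor_def by blast

lemma ext2_tensorD:
  assumes "T \<in> ext2_tensor"
  shows "T $ ((i, i), k) = 0" "T $ ((j, i), k) = - (T $ ((i, j), k))"
  using assms unfolding ext2_tensor_def by blast+

text \<open>The matrix of \<open>\<alpha>\<^sub>1\<close> is \<open>u\<close>; the structure maps of the cone have capital letters.\<close>

locale linked_structure_maps = structure_maps a1 a2 a3 w31 w21 w11 w32 w22 w122 w23
  for a1 :: "'a::comm_ring_1^5" and a2 :: "'a^6^5" and a3 :: "'a^2^6"
    and w31 w21 w11 w32 w22 w122 w23 +
  fixes u :: "'a^3^5"
    and W31 :: "('a^(2 + 3)) list \<Rightarrow> 'a^(6 + 3)"
    and W32 :: "('a^(2 + 3)) list \<Rightarrow> 'a^(5 \<times> (6 + 3))"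
    and W33 :: "('a^(2 + 3)) list \<Rightarrow> 'a^(2 + 3) \<Rightarrow> 'a^((5 \<times> 5) \<times> (6 + 3))"
  assumes W31: "cone_w31 u w21 w22 W31"
    and W32: "cone_w32 u w21 w22 W32"
    and alt_W33: "\<And>y. alternating_map 5 (\<lambda>ys. W33 ys y)"
    and lin_W33: "\<And>ys. length ys = 5 \<Longrightarrow> linear_map (W33 ys)"
    and W33_s: "\<And>j. j\<in>{1..3} \<Longrightarrow>
      W33 [std_l 1, std_l 2, std_r 1, std_r 2, std_r 3] (std_r j) =
        (\<Sum>i\<in>{1..5}. \<Sum>k\<in>{i<..5}. \<Sum>h\<in>{1..6}.
           ext2_pairing (w22 [std i, std k, u *v std j] (std h)) (std 1) (std 2) *s
             tensor (wedge2 (std i) (std k)) (std_l h))"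
    and W33_g: "\<And>v. v\<in>{1..2} \<Longrightarrow>
      W33 [std_l 1, std_l 2, std_r 1, std_r 2, std_r 3] (std_l v) =
        (\<Sum>i\<in>{1..5}. \<Sum>k\<in>{i<..5}. \<Sum>h\<in>{1..6}.
           ext2_tensor_pairing
             (w23 [std i, std k, u *v std 1, u *v std 2, u *v std 3] (std h))
             (std 1) (std 2) (std v) *s
             tensor (wedge2 (std i) (std k)) (std_l h))"
begin

abbreviation "alpha j \<equiv> u *v std j"

lemma linear_form_w21:
  "linear_form (\<lambda>x. w21 x f $ v)" "linear_form (\<lambda>f. w21 x f $ v)"
proof -
  have "linear_map (\<lambda>x. w21 x f)" "linear_map (w21 x)"
    using w21 by (simp_all add: is_w21_def)
  then show "linear_form (\<lambda>x. w21 x f $ v)" "linear_form (\<lambda>f. w21 x f $ v)"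
    by (auto intro: linear_form_comp linear_form_component)
qed

lemma linear_form_pair22:
  "linear_form (\<lambda>x. pair22 [x, y, z] f)" "linear_form (\<lambda>y. pair22 [x, y, z] f)" "linear_form (pair22 [x, y, z])"
proof -
  have p: "linear_form (\<lambda>T :: 'a^(2 \<times> 2). ext2_pairing T g g')" for g g'
    by (simp add: linear_form_def ext2_pairing_linear)
  have "linear_map (w22 [x, y, z])"
    using w22 by (simp add: is_w22_def)
  then show "linear_form (pair22 [x, y, z])"
    unfolding pair22_def by (rule linear_form_comp[OF _ p])
  show "linear_form (\<lambda>x. pair22 [x, y, z] f)" "linear_form (\<lambda>y. pair22 [x, y, z] f)"
    unfolding pair22_def
    by (rule linear_form_comp[OF alternating_map_3D(1)[OF alt_w22] p],
        rule linear_form_comp[OF alternating_map_3D(2)[OF alt_w22] p])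
qed

lemma pair22_vanish: "pair22 [x, x, z] f = 0" "pair22 [x, z, z] f = 0"
  using alternating_map_3D(4,5)[OF alt_w22] by (simp_all add: pair22_def ext2_pairing_linear del: One_nat_def)

lemma pair22_skew: "pair22 [x, z, y] f = - pair22 [x, y, z] f"
proof -
  have "w22 [x, z, y] f = - w22 [x, y, z] f"
    using alternating_map_swap[OF alt_w22, of "[x, y, z]" 1 2 f] by simp
  then show ?thesis
    using ext2_pairing_linear(2)[of "-1"] by (simp add: pair22_def vector_sneg_minus1[symmetric] del: One_nat_def)
qed

lemma linear_form_pair23:
  "linear_form (\<lambda>x. pair23 v [x, y, b, c, d] f)" "linear_form (\<lambda>y. pair23 v [x, y, b, c, d] f)" "linear_form (pair23 v [x, y, b, c, d])"
proof -
  have p: "linear_form (\<lambda>T :: 'a^((2 \<times> 2) \<times> 2). ext2_tensor_pairing T g g' h)" for g g' h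
    by (simp add: linear_form_def ext2_tensor_pairing_linear)
  have "linear_map (w23 [x, y, b, c, d])"
    using w23 by (simp add: is_w23_def)
  then show "linear_form (pair23 v [x, y, b, c, d])"
    unfolding pair23_def by (rule linear_form_comp[OF _ p])
  have l: "linear_map (\<lambda>x. w23 [x, y, b, c, d] f)" "linear_map (\<lambda>y. w23 [x, y, b, c, d] f)"
    using alternating_map_linear[OF alt_w23, of "[x, y, b, c, d]" 0]
      alternating_map_linear[OF alt_w23, of "[x, y, b, c, d]" 1] by simp_all
  show "linear_form (\<lambda>x. pair23 v [x, y, b, c, d] f)" "linear_form (\<lambda>y. pair23 v [x, y, b, c, d] f)"
    unfolding pair23_def by (rule linear_form_comp[OF l(1) p], rule linear_form_comp[OF l(2) p])
qed

lemma pair23_vanish: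
  assumes "length xs = 5" "i < j" "j < 5" "xs ! i = xs ! j" shows "pair23 v xs f = 0"
  using alternating_map_vanish[OF alt_w23 assms] by (simp add: pair23_def ext2_tensor_pairing_linear del: One_nat_def)

lemma pair23_swap: "pair23 v [y, x, b, c, d] f = - pair23 v [x, y, b, c, d] f"
proof -
  have "w23 [y, x, b, c, d] f = - w23 [x, y, b, c, d] f"
    using alternating_map_swap[OF alt_w23, of "[x, y, b, c, d]" 0 1 f] by simp
  then show ?thesis
    using ext2_tensor_pairing_linear(2)[of "-1"] by (simp add: pair23_def vector_sneg_minus1[symmetric] del: One_nat_def)
qed

lemma W31_skew: "W31 [y, z] = - W31 [z, y]"
proof -
  have "alternating_map 2 W31" using W31 by (simp add: cone_w31_def)
  from alternating_map_swap[OF this, of "[z, y]" 0 1] show ?thesis by simp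
qed

lemma W31_ss:
  "W31 [std_r 1, std_r 2] = - std_r 3" "W31 [std_r 1, std_r 3] = std_r 2" "W31 [std_r 2, std_r 3] = - std_r 1"
proof -
  have *: "W31 [std_r i, std_r j] = (-1) ^ (i + j) *s std_r k" if "{i, j, k} = {1, 2, 3}" "i < j" for i j k
    using W31 that unfolding cone_w31_def by blast
  have "{1, 2, 3} = {1, 2, 3::nat}" "{1, 3, 2} = {1, 2, 3::nat}" "{2, 3, 1} = {1, 2, 3::nat}" by auto
  from *[OF this(1)] *[OF this(2)] *[OF this(3)]
  show "W31 [std_r 1, std_r 2] = - std_r 3" "W31 [std_r 1, std_r 3] = std_r 2" "W31 [std_r 2, std_r 3] = - std_r 1"
    by (simp_all add: vec_eq_iff del: One_nat_def)
qed

lemma W31_sg: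
  assumes "i \<in> {1..3}" "t \<in> {1..2}"
  shows "scalar_product (W31 [std_r i, std_l t]) v = w21 (alpha i) (left_part v) $ of_nat t"
proof -
  have "W31 [std_r i, std_l t] = (\<Sum>h\<in>{1..6}. scalar_product (w21 (alpha i) (std h)) (std t) *s std_l h)"
    using W31 assms unfolding cone_w31_def by blast
  moreover have "scalar_product w (std t) = w $ of_nat t" for w :: "'a^2"
    by (simp add: scalar_product_def std_def axis_nth_if if_distrib cong: if_cong)
  ultimately show ?thesis
    by (simp only: eval_cone_w31[OF linear_form_w21(2)])
qed

lemma W31_gg:
  "scalar_product (W31 [std_l 1, std_l 2]) v = pair22 [alpha 1, alpha 2, alpha 3] (left_part v)"
proof -
  have "W31 [std_l 1, std_l 2] = (\<Sum>h\<in>{1..6}. pair22 [alpha 1, alpha 2, alpha 3] (std h) *s std_l h)"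
    using W31 unfolding cone_w31_def pair22_def by blast
  then show ?thesis by (simp only: eval_cone_w31[OF linear_form_pair22(3)])
qed

lemma W32_g:
  assumes "t \<in> {1..2}"
  shows "scalar_product (tensor_row e (W32 [std_l t, std_r 1, std_r 2, std_r 3])) v =
    w21 (axis e 1) (left_part v) $ of_nat t"
proof -
  have "W32 [std_l t, std_r 1, std_r 2, std_r 3] =
    (\<Sum>i\<in>{1..5}. \<Sum>h\<in>{1..6}. scalar_product (w21 (std i) (std h)) (std t) *s
             tensor (std i) (std_l h))"
    using W32 assms unfolding cone_w32_def by blast
  moreover have "scalar_product w (std t) = w $ of_nat t" for w :: "'a^2"
    by (simp add: scalar_product_def std_def axis_nth_if if_distrib cong: if_cong)
  ultimately show ?thesis
    by (simp only: eval_cone_w32[OF linear_form_w21])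
qed

lemma W32_gg:
  assumes "p \<in> {1..3}" "q \<in> {p<..3}"
  shows "scalar_product (tensor_row e (W32 [std_l 1, std_l 2, std_r p, std_r q])) v =
    - pair22 [axis e 1, alpha p, alpha q] (left_part v)"
proof -
  have "W32 [std_l 1, std_l 2, std_r p, std_r q] =
    - (\<Sum>i\<in>{1..5}. \<Sum>h\<in>{1..6}. pair22 [std i, alpha p, alpha q] (std h) *s
             tensor (std i) (std_l h))"
    using W32 assms unfolding cone_w32_def pair22_def by blast
  then show ?thesis
    by (simp only: tensor_row_linear scalar_product_linear eval_cone_w32[OF linear_form_pair22(1,3)])
qed

lemma u_mult: "u *v t = t $ 1 *s alpha 1 + t $ 2 *s alpha 2 + t $ 3 *s alpha 3"
  by (subst linear_map_expand[OF matrix_vector_mult_linear]) (simp add: sum_3 std_def)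

text \<open>The image of \<open>w\<^sup>(\<^sup>3\<^sup>)\<^sub>3(\<epsilon> \<otimes> s\<^sub>j)\<close>, evaluated.  The summand \<open>a\<^sub>2 f\<close> of \<open>a\<^sub>2 f + \<alpha>\<^sub>1 \<tau>\<close> gives the products of
pairings by \<open>pair22_boundary\<close>.\<close>

lemma cone_lift_s:
  assumes j: "j \<in> {1..3}"
    and d: "\<And>b. scalar_product (d *v b) v = scalar_product b (a2 *v left_part v + u *v right_part v)"
  shows "quad_eval v (tensor_row e (ext2_tensor_map
      (\<lambda>g g' f. tensor g (sym_prod (d *v g') f) - tensor g' (sym_prod (d *v g) f))
      (W33 [std_l 1, std_l 2, std_r 1, std_r 2, std_r 3] (std_r j)))) =
    w21 (axis e 1) (left_part v) $ 2 * w21 (alpha j) (left_part v) $ 1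
    - w21 (axis e 1) (left_part v) $ 1 * w21 (alpha j) (left_part v) $ 2
    + right_part v $ 1 * pair22 [axis e 1, alpha 1, alpha j] (left_part v)
    + right_part v $ 2 * pair22 [axis e 1, alpha 2, alpha j] (left_part v)
    + right_part v $ 3 * pair22 [axis e 1, alpha 3, alpha j] (left_part v)"
proof -
  let ?f = "left_part v"
  have "quad_eval v (tensor_row e (ext2_tensor_map
      (\<lambda>g g' f. tensor g (sym_prod (d *v g') f) - tensor g' (sym_prod (d *v g) f))
      (W33 [std_l 1, std_l 2, std_r 1, std_r 2, std_r 3] (std_r j)))) =
    pair22 [axis e 1, a2 *v ?f + u *v right_part v, alpha j] ?f"
    by (rule eval_cone_lift[where C = "\<lambda>x y f. pair22 [x, y, alpha j] f"])
      (use W33_s[OF j] in \<open>simp_all only: linear_form_pair22 pair22_vanish d pair22_def[symmetric]\<close>)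
  also have "\<dots> = pair22 [axis e 1, a2 *v ?f, alpha j] ?f + pair22 [axis e 1, u *v right_part v, alpha j] ?f"
    using linear_form_pair22(2) by (simp add: linear_form_def)
  also have "pair22 [axis e 1, a2 *v ?f, alpha j] ?f = - pair22 [axis e 1, alpha j, a2 *v ?f] ?f"
    by (rule pair22_skew)
  finally show ?thesis
    unfolding pair22_boundary u_mult[of "right_part v"] using linear_form_pair22(2) by (simp add: linear_form_def)
qed

text \<open>The image of \<open>w\<^sup>(\<^sup>3\<^sup>)\<^sub>3(\<epsilon> \<otimes> \<gamma>\<^sub>t)\<close>, evaluated.  The summand \<open>\<alpha>\<^sub>1 \<tau>\<close> of \<open>a\<^sub>2 f + \<alpha>\<^sub>1 \<tau>\<close> contributes nothing, since
\<open>w\<^sup>(\<^sup>2\<^sup>)\<^sub>3\<close> already contains \<open>\<alpha>\<^sub>1(s\<^sub>1)\<close>, \<open>\<alpha>\<^sub>1(s\<^sub>2)\<close>, \<open>\<alpha>\<^sub>1(s\<^sub>3)\<close>; the summand \<open>a\<^sub>2 f\<close> is \<open>pair23_boundary\<close>.\<close>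

lemma cone_lift_g:
  assumes t: "t \<in> {1..2}"
    and d: "\<And>b. scalar_product (d *v b) v = scalar_product b (a2 *v left_part v + u *v right_part v)"
  shows "quad_eval v (tensor_row e (ext2_tensor_map
      (\<lambda>g g' f. tensor g (sym_prod (d *v g') f) - tensor g' (sym_prod (d *v g) f))
      (W33 [std_l 1, std_l 2, std_r 1, std_r 2, std_r 3] (std_l t)))) =
    - (w21 (axis e 1) (left_part v) $ of_nat t * pair22 [alpha 1, alpha 2, alpha 3] (left_part v))
    + w21 (alpha 1) (left_part v) $ of_nat t * pair22 [axis e 1, alpha 2, alpha 3] (left_part v)
    - w21 (alpha 2) (left_part v) $ of_nat t * pair22 [axis e 1, alpha 1, alpha 3] (left_part v)
    + w21 (alpha 3) (left_part v) $ of_nat t * pair22 [axis e 1, alpha 1, alpha 2] (left_part v)"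
proof -
  let ?f = "left_part v" and ?t = "of_nat t :: 2"
  have std_t: "std t = (axis ?t 1 :: 'a^2)" by (simp add: std_def)
  have lin: "linear_form (\<lambda>y. pair23 ?t [x, y, alpha 1, alpha 2, alpha 3] f)" for x f
    by (rule linear_form_pair23)
  have van: "pair23 ?t [x, alpha 1, alpha 1, alpha 2, alpha 3] f = 0"
    "pair23 ?t [x, alpha 2, alpha 1, alpha 2, alpha 3] f = 0"
    "pair23 ?t [x, alpha 3, alpha 1, alpha 2, alpha 3] f = 0" for x f
    by ((rule pair23_vanish[of _ 1 2]; simp), (rule pair23_vanish[of _ 1 3]; simp), (rule pair23_vanish[of _ 1 4]; simp))
  have "quad_eval v (tensor_row e (ext2_tensor_map
      (\<lambda>g g' f. tensor g (sym_prod (d *v g') f) - tensor g' (sym_prod (d *v g) f))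
      (W33 [std_l 1, std_l 2, std_r 1, std_r 2, std_r 3] (std_l t)))) =
    pair23 ?t [axis e 1, a2 *v ?f + u *v right_part v, alpha 1, alpha 2, alpha 3] ?f"
  proof (rule eval_cone_lift[where C = "\<lambda>x y f. pair23 ?t [x, y, alpha 1, alpha 2, alpha 3] f"])
    show "pair23 ?t [x, x, alpha 1, alpha 2, alpha 3] f = 0" for x f
      by (rule pair23_vanish[of _ 0 1]) simp_all
  qed (use W33_g[OF t] in \<open>simp_all only: linear_form_pair23 d pair23_def[symmetric] std_t\<close>)
  also have "\<dots> = pair23 ?t [axis e 1, a2 *v ?f, alpha 1, alpha 2, alpha 3] ?f"
    using lin[of "axis e 1" ?f] unfolding u_mult[of "right_part v"] linear_form_def by (simp only: van) simp
  also have "\<dots> = - pair23 ?t [a2 *v ?f, axis e 1, alpha 1, alpha 2, alpha 3] ?f"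
    by (rule pair23_swap)
  finally show ?thesis
    unfolding pair23_boundary by simp
qed

lemma W33_in_ext2_tensor:
  assumes "length ys = 5"
  shows "W33 ys y \<in> ext2_tensor"
proof (rule alternating_map_mem_of_basis[OF alt_W33 _ basis_cone(2,3) _ _ _ _ assms])
  show zero: "0 \<in> ext2_tensor"
    by (rule ext2_tensorI) simp_all
  show add: "v + w \<in> ext2_tensor" if "v \<in> ext2_tensor" "w \<in> ext2_tensor"
    for v w :: "'a^((5 \<times> 5) \<times> (6 + 3))"
  proof (rule ext2_tensorI)
    show "(v + w) $ ((i, i), k) = 0" for i k
      using that[THEN ext2_tensorD(1)] by simp
    show "(v + w) $ ((j, i), k) = - ((v + w) $ ((i, j), k))" for i j k
      using that[THEN ext2_tensorD(2), of j i k] by simp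
  qed
  show scale: "c *s v \<in> ext2_tensor" if "v \<in> ext2_tensor"
    for c and v :: "'a^((5 \<times> 5) \<times> (6 + 3))"
  proof (rule ext2_tensorI)
    show "(c *s v) $ ((i, i), k) = 0" for i k
      using that[THEN ext2_tensorD(1)] by simp
    show "(c *s v) $ ((j, i), k) = - ((c *s v) $ ((i, j), k))" for i j k
      using that[THEN ext2_tensorD(2), of j i k] by simp
  qed
  have sum: "(\<Sum>i\<in>A. g i) \<in> ext2_tensor" if "\<And>i. i \<in> A \<Longrightarrow> g i \<in> ext2_tensor"
    for A :: "'i set" and g :: "'i \<Rightarrow> 'a^((5 \<times> 5) \<times> (6 + 3))"
    using that by (induction A rule: infinite_finite_induct) (auto intro: zero add)
  have wedge: "tensor (wedge2 v w) z \<in> ext2_tensor" for v w :: "'a^5" and z :: "'a^(6 + 3)"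
    by (rule ext2_tensorI) (simp_all add: tensor_def wedge2_def algebra_simps)
  let ?ys = "[std_l 1, std_l 2, std_r 1, std_r 2, std_r 3] :: ('a^(2 + 3)) list"
  have s: "W33 ?ys (axis (Inr j) 1) \<in> ext2_tensor" for j
  proof -
    have "W33 ?ys (std_r i) \<in> ext2_tensor" if "i \<in> {1..3}" for i
      unfolding W33_s[OF that] by (intro sum scale wedge)
    from this[of 1] this[of 2] this[of 3] show ?thesis
      using exhaust_3[of j] by (auto simp: std_r_def)
  qed
  have g: "W33 ?ys (axis (Inl j) 1) \<in> ext2_tensor" for j
  proof -
    have "W33 ?ys (std_l i) \<in> ext2_tensor" if "i \<in> {1..2}" for i
      unfolding W33_g[OF that] by (intro sum scale wedge)
    from this[of 1] this[of 2] show ?thesis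
      using exhaust_2[of j] by (auto simp: std_l_def)
  qed
  have "W33 ?ys y = (\<Sum>i\<in>UNIV. y $ i *s W33 ?ys (axis i 1))"
    by (rule linear_map_expand, rule lin_W33) simp
  also have "\<dots> \<in> ext2_tensor"
    unfolding sum_Plus_UNIV by (intro add sum scale s g)
  finally show "W33 (map (\<lambda>i. axis i 1) [Inl 1, Inl 2, Inr 1, Inr 2, Inr 3]) y \<in> ext2_tensor"
    by (simp only: basis_cone(1))
qed simp

text \<open>For each of the five basis vectors both sides are compared at every \<open>(e, v)\<close>; the equation for
\<open>w\<^sup>(\<^sup>3\<^sup>)\<^sub>3\<close> sees the cone through the transpose of \<open>d\<^sub>3\<close>.\<close>

lemma is_w33_of_cone:
  assumes d: "\<And>b v. scalar_product (d *v b) v = scalar_product b (a2 *v left_part v + u *v right_part v)"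
  shows "is_w33 (d1, d2, d) W31 W32 [std_l 1, std_l 2, std_r 1, std_r 2, std_r 3] W33"
proof -
  let ?ys = "[std_l 1, std_l 2, std_r 1, std_r 2, std_r 3] :: ('a^(2 + 3)) list"
  let ?\<phi> = "\<lambda>g g' f. tensor g (sym_prod (d *v g') f) - tensor g' (sym_prod (d *v g) f)"
  let ?R = "\<lambda>k. \<Sum>i\<in>{1..5} - {k}. (-1) ^ (i + 1) *s
           tensor_map (\<lambda>g f. tensor g (sym_prod f (W31 [nth1 ?ys k, nth1 ?ys i]))) (W32 (omit i ?ys))"
  have R: "quad_eval v (tensor_row e (?R k)) = (\<Sum>i\<in>{1..5} - {k}. (-1) ^ (i + 1) *
      (scalar_product (tensor_row e (W32 (omit i ?ys))) v * scalar_product (W31 [nth1 ?ys k, nth1 ?ys i]) v))"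
    for k v e
    unfolding tensor_row_sum quad_eval_sum tensor_row_linear quad_eval_linear quad_eval_tensor_map ..
  have neg: "scalar_product (W31 [std_l 2, std_l 1]) v = - pair22 [alpha 1, alpha 2, alpha 3] (left_part v)"
    "scalar_product (W31 [std_l t, std_r i]) v = - w21 (alpha i) (left_part v) $ of_nat t"
      if "i \<in> {1..3}" "t \<in> {1..2}" for v i t
    unfolding W31_skew[of "std_l 2"] W31_skew[of "std_l t"] scalar_product_linear W31_gg W31_sg[OF that]
    by (rule refl)+
  have ss: "scalar_product (W31 [std_r 1, std_r 2]) v = - right_part v $ 3"
      "scalar_product (W31 [std_r 2, std_r 1]) v = right_part v $ 3"
      "scalar_product (W31 [std_r 1, std_r 3]) v = right_part v $ 2"
      "scalar_product (W31 [std_r 3, std_r 1]) v = - right_part v $ 2"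
      "scalar_product (W31 [std_r 2, std_r 3]) v = - right_part v $ 1"
      "scalar_product (W31 [std_r 3, std_r 2]) v = right_part v $ 1" for v
    unfolding W31_skew[of "std_r 2" "std_r 1"] W31_skew[of "std_r 3"] W31_ss
      scalar_product_linear scalar_product_std_r by simp_all
  have mem: "1 \<in> {1..3::nat}" "2 \<in> {1..3::nat}" "3 \<in> {1..3::nat}" "1 \<in> {1..2::nat}" "2 \<in> {1..2::nat}"
    "2 \<in> {1<..3::nat}" "3 \<in> {1<..3::nat}" "3 \<in> {2<..3::nat}" by simp_all
  note vals = alternating_signs nth1_5 omit_5 neg(1)[OF mem(1,4)] neg(2)[OF mem(1,4)] neg(2)[OF mem(2,4)] neg(2)[OF mem(3,4)]
    neg(2)[OF mem(1,5)] neg(2)[OF mem(2,5)] neg(2)[OF mem(3,5)] ss W31_gg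
    W31_sg[OF mem(1,4)] W31_sg[OF mem(2,4)] W31_sg[OF mem(3,4)]
    W31_sg[OF mem(1,5)] W31_sg[OF mem(2,5)] W31_sg[OF mem(3,5)]
    W32_g[OF mem(4)] W32_g[OF mem(5)] W32_gg[OF mem(1,6)] W32_gg[OF mem(1,7)] W32_gg[OF mem(2,8)]
    of_nat_1 of_nat_numeral pair22_vanish
  have "quad_eval v (tensor_row e (ext2_tensor_map ?\<phi> (W33 ?ys (nth1 ?ys k)))) = quad_eval v (tensor_row e (?R k))"
    if "k \<in> {1..5}" for k v e
  proof -
    let ?f = "left_part v" and ?e = "axis e 1"
    have skew: "pair22 [?e, alpha 3, alpha 1] ?f = - pair22 [?e, alpha 1, alpha 3] ?f"
      "pair22 [?e, alpha 3, alpha 2] ?f = - pair22 [?e, alpha 2, alpha 3] ?f"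
      "pair22 [?e, alpha 2, alpha 1] ?f = - pair22 [?e, alpha 1, alpha 2] ?f"
      by (rule pair22_skew)+
    have "k = 1 \<or> k = 2 \<or> k = 3 \<or> k = 4 \<or> k = 5"
      using that by auto
    then consider "k = 1" | "k = 2" | "k = 3" | "k = 4" | "k = 5" by blast
    then show ?thesis
    proof cases
      case 1
      show ?thesis
        unfolding 1 unfolding R unfolding sum_1_5_remove vals cone_lift_g[OF mem(4) d]
        by (simp add: algebra_simps)
    next
      case 2
      show ?thesis
        unfolding 2 unfolding R unfolding sum_1_5_remove vals cone_lift_g[OF mem(5) d]
        by (simp add: algebra_simps)
    next
      case 3
      show ?thesis
        unfolding 3 unfolding R unfolding sum_1_5_remove vals cone_lift_s[OF mem(1) d] skew
        by (simp add: algebra_simps)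
    next
      case 4
      show ?thesis
        unfolding 4 unfolding R unfolding sum_1_5_remove vals cone_lift_s[OF mem(2) d] skew
        by (simp add: algebra_simps)
    next
      case 5
      show ?thesis
        unfolding 5 unfolding R unfolding sum_1_5_remove vals cone_lift_s[OF mem(3) d] skew
        by (simp add: algebra_simps)
    qed
  qed
  then have "ext2_tensor_map ?\<phi> (W33 ?ys (nth1 ?ys k)) = ?R k" if "k \<in> {1..5}" for k
    using that by (blast intro: tensor_row_eqI quad_eval_eqI)
  then show ?thesis
    unfolding is_w33_def using alt_W33 lin_W33 W33_in_ext2_tensor by blast
qed

end

section \<open>The residue characteristic\<close>

text \<open>An ideal maximal among those containing \<open>r\<close> but not 1 is a maximal ideal, hence equals \<open>m\<close>.  Chains
of ideals have a largest element because the ring is Noetherian.\<close>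

lemma unit_of_notin_maximal_ideal:
  fixes m :: "'a::comm_ring_1 set"
  assumes loc: "noetherian_local_ring m" and r: "r \<notin> m"
  obtains c where "r * c = 1"
proof -
  interpret noetherian_ring "RR :: 'a ring"
    using loc by (simp add: noetherian_local_ring_def)
  interpret cring "RR :: 'a ring"
    by (intro cring.intro ring_axioms monoid.monoid_comm_monoidI monoid_axioms)
      (simp add: RR_def mult.commute)
  have "\<exists>c. r * c = 1"
  proof (rule ccontr)
    assume nonunit: "\<not> (\<exists>c. r * c = 1)"
    define A where "A = {K. ideal K (RR :: 'a ring) \<and> r \<in> K \<and> 1 \<notin> K}"
    let ?P = "cgenideal RR r"
    have "?P \<in> A"
      using nonunit cgenideal_ideal[of r] cgenideal_self[of r]
      by (auto simp: A_def cgenideal_def RR_def mult.commute)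
    moreover have "\<Union>C \<in> A" if "C \<noteq> {}" "subset.chain A C" for C
    proof -
      have "subset.chain {K. ideal K (RR :: 'a ring)} C"
        using that(2) by (auto simp: subset.chain_def A_def)
      then have "\<Union>C \<in> C"
        by (rule ideal_chain_is_trivial[OF that(1)])
      then show ?thesis
        using that(2) by (auto simp: subset.chain_def)
    qed
    ultimately obtain M where M: "M \<in> A" "\<And>K. K \<in> A \<Longrightarrow> M \<subseteq> K \<Longrightarrow> K = M"
      using subset_Zorn_nonempty[of A] by blast
    have "maximalideal M RR"
    proof (rule maximalidealI)
      show "ideal M RR" using M by (simp add: A_def)
      show "carrier RR \<noteq> M" using M by (auto simp: A_def RR_def)
    next
      fix K assume K: "ideal K (RR :: 'a ring)" "M \<subseteq> K" "K \<subseteq> carrier RR"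
      show "K = M \<or> K = carrier RR"
      proof (cases "1 \<in> K")
        case True
        then show ?thesis
          using ideal.one_imp_carrier[OF K(1)] by (simp add: RR_def)
      next
        case False
        then show ?thesis using K M by (auto simp: A_def)
      qed
    qed
    then have "M = m"
      using loc by (simp add: noetherian_local_ring_def)
    then show False
      using M r by (simp add: A_def)
  qed
  then show ?thesis using that by blast
qed

lemma two_half:
  fixes m :: "'a::comm_ring_1 set"
  assumes "noetherian_local_ring m" "2 \<notin> m"
  shows "2 * half = (1 :: 'a)"
proof -
  obtain c :: 'a where c: "2 * c = 1"
    using unit_of_notin_maximal_ideal[OF assms] .
  have "half = c"
    unfolding half_def
  proof (rule the_equality)
    fix d :: 'a assume "2 * d = 1"
    then have "d = (2 * c) * d" by (simp add: c)
    also have "\<dots> = c * (2 * d)" by (simp add: mult_ac)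
    finally show "d = c" using \<open>2 * d = 1\<close> by simp
  qed (rule c)
  then show ?thesis using c by simp
qed

section \<open>The lift on the linked resolution\<close>

theorem theorem4p5:
  fixes m I J :: "'a::comm_ring_1 set"
    and a1 :: "'a^5" and a2 :: "'a^6^5" and a3 :: "'a^2^6"
    and x :: "'a^3" and u :: "'a^3^5"
    and w31 :: "('a^5) list \<Rightarrow> 'a^6"
    and w21 :: "'a^5 \<Rightarrow> 'a^6 \<Rightarrow> 'a^2"
    and w11 :: "('a^5) list \<Rightarrow> 'a^2"
    and w32 :: "('a^5) list \<Rightarrow> 'a^(2 \<times> 6)"
    and w22 :: "('a^5) list \<Rightarrow> 'a^6 \<Rightarrow> 'a^(2 \<times> 2)"
    and w122 :: "('a^5) list \<Rightarrow> 'a^(2 uprod)"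
    and w23 :: "('a^5) list \<Rightarrow> 'a^6 \<Rightarrow> 'a^((2 \<times> 2) \<times> 2)"
    and D :: "('a, 2 + 3, 6 + 3, 5) cplx3"
    and W31 :: "('a^(2 + 3)) list \<Rightarrow> 'a^(6 + 3)"
    and W32 :: "('a^(2 + 3)) list \<Rightarrow> 'a^(5 \<times> (6 + 3))"
    and W33 :: "('a^(2 + 3)) list \<Rightarrow> 'a^(2 + 3) \<Rightarrow> 'a^((5 \<times> 5) \<times> (6 + 3))"
  assumes "gorenstein_local_ring m"
    and "infinite (carrier (RR Quot m))"
    and "2 \<notin> m" and "3 \<notin> m"
    and "perfect_ideal I" and "ideal_height I = 3"
    and "minimal_free_resolution3 m I (a1, a2, a3)"
    and "{x $ 1, x $ 2, x $ 3} \<subseteq> I" and "regular_sequence [x $ 1, x $ 2, x $ 3]"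
    and "J = colon_ideal (genideal RR {x $ 1, x $ 2, x $ 3}) I"
    and "\<forall>j. scalar_product a1 (u *v axis j 1) = x $ j"
    and "is_w31 (a1, a2, a3) w31"
    and "is_w21 (a1, a2, a3) w31 w21"
    and "is_w11 (a1, a2, a3) w31 w11"
    and "is_w32 (a1, a2, a3) w31 w32"
    and "is_w22 (a1, a2, a3) w31 w21 w11 w32 w22"
    and "is_w122 (a1, a2, a3) w31 w11 [std 1, std 2, std 3, std 4, std 5] w122"
    and "is_w23 (a1, a2, a3) w21 w32 w122 [std 1, std 2, std 3, std 4, std 5] w23"
    and "D = mapping_cone (a1, a2, a3) x u w31 w11"
    and "cone_w31 u w21 w22 W31"
    and "cone_w32 u w21 w22 W32"
    and "\<forall>y. alternating_map 5 (\<lambda>ys. W33 ys y)"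
    and "\<forall>ys. length ys = 5 \<longrightarrow> linear_map (W33 ys)"
    and "\<forall>j\<in>{1..3}.
      W33 [std_l 1, std_l 2, std_r 1, std_r 2, std_r 3] (std_r j) =
        (\<Sum>i\<in>{1..5}. \<Sum>k\<in>{i<..5}. \<Sum>h\<in>{1..6}.
           ext2_pairing (w22 [std i, std k, u *v std j] (std h)) (std 1) (std 2) *s
             tensor (wedge2 (std i) (std k)) (std_l h))"
    and "\<forall>v\<in>{1..2}.
      W33 [std_l 1, std_l 2, std_r 1, std_r 2, std_r 3] (std_l v) =
        (\<Sum>i\<in>{1..5}. \<Sum>k\<in>{i<..5}. \<Sum>h\<in>{1..6}.
           ext2_tensor_pairing
             (w23 [std i, std k, u *v std 1, u *v std 2, u *v std 3] (std h))
             (std 1) (std 2) (std v) *s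
             tensor (wedge2 (std i) (std k)) (std_l h))"
  shows "is_w33 D W31 W32 [std_l 1, std_l 2, std_r 1, std_r 2, std_r 3] W33"
proof -
  let ?D = "mapping_cone (a1, a2, a3) x u w31 w11"
  have res: "range ((*v) a2) = {v. scalar_product a1 v = 0}" "inj ((*v) a3)"
    using assms(7) by (simp_all add: minimal_free_resolution3_def free_resolution3_def)
  have complex: "scalar_product a1 (a2 *v f) = 0" for f
    using res(1) by auto
  have half: "2 * half = (1 :: 'a)"
    by (rule two_half[of m]) (use assms(1,3) in \<open>simp_all add: gorenstein_local_ring_def\<close>)
  interpret linked_structure_maps a1 a2 a3 w31 w21 w11 w32 w22 w122 w23 u W31 W32 W33
    by (intro linked_structure_maps.intro structure_maps.intro linked_structure_maps_axioms.intro
        half complex res(2) assms(12-18,20,21)) (use assms(22-25) in blast)+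
  have "is_w33 (fst ?D, fst (snd ?D), snd (snd ?D)) W31 W32
      [std_l 1, std_l 2, std_r 1, std_r 2, std_r 3] W33"
    by (rule is_w33_of_cone) (rule scalar_product_mapping_cone_d3)
  then show ?thesis
    by (simp only: assms(19) prod.collapse)
qed

end
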